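(* Let $\alpha$ be an arbitrary finite alphabet with an involution $\tau:\alpha\to\alpha$, let $\Delta_\alpha=\{(a,a,a)\}_{a\in\alpha}$, and let $\mathrm{crs}(\alpha/\tau)$ be a complete system of representatives of $\alpha/\tau$. Then for $L\subset\mathrm{crs}(\alpha/\tau)$, the polynomials $J(\mathcal{U}_L(P))$ are $\Delta_\alpha$-homotopy invariants of nanophrases $P$ over $\alpha$: if $P\simeq_{\Delta_\alpha}P'$, then $J(\mathcal{U}_L(P))=J(\mathcal{U}_L(P'))$.
   Context: **Nanophrases.** An involution is a self-map whose square is the identity (possibly the identity). An $\alpha$-alphabet is a finite set $\mathcal{A}$ with a projection $\mathcal{A}\to\alpha$, $A\mapsto|A|$. A nanophrase of length $k\ge1$ over $\alpha$ is a pair $(\mathcal{A},P)$ with $\mathcal{A}$ an $\alpha$-alphabet and $P=w_1|\cdots|w_k$ a sequence of $k$ (possibly empty) words in $\mathcal{A}$ such that every letter of $\mathcal{A}$ occurs exactly twice in $w_1\cdots w_k$. Isomorphism: a projection-preserving bijection of alphabets carrying components to corresponding components. **$S$-homotopy.** For $(\alpha,\tau)$ and $S\subset\alpha^3$, $\simeq_S$ is the equivalence relation generated by isomorphisms and the moves (with $x,y,z,t$ words in the remaining letters, possibly containing the separator $|$): (H1) $(\mathcal{A},xAAy)\to(\mathcal{A}\setminus\{A\},xy)$; (H2) $(\mathcal{A},xAByBAz)\to(\mathcal{A}\setminus\{A,B\},xyz)$ if $\tau(|A|)=|B|$; (H3) $(\mathcal{A},xAByACzBCt)\to(\mathcal{A},xBAyCAzCBt)$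 if $(|A|,|B|,|C|)\in S$. **The map $\mathcal{U}_L$.** An orbit of $\tau$ is free if it has two elements. For a letter $A$, $\mathrm{sign}_L(A)=1$ if $|A|\in L$ and the orbit of $|A|$ is free; $-1$ if $|A|\in\tau(L)$ and the orbit of $|A|$ is free; $0$ otherwise. Let $\alpha_0=\{a,b\}$, $\tau_0:a\leftrightarrow b$. $\mathcal{U}_L(P)$ is the nanophrase over $\alpha_0$ obtained from $P$ by deleting (both occurrences of) all letters with $\mathrm{sign}_L=0$, keeping all separators, and giving each remaining letter $A$ the projection $a$ if $\mathrm{sign}_L(A)=1$ and $b$ if $\mathrm{sign}_L(A)=-1$. **The Jones polynomial $J$.** A nanophrase over $\alpha_0$ is regarded as a nanophrase over $\alpha_1=\{1,-1\}$ via $a\mapsto1$, $b\mapsto-1$. For a nanophrase $(\mathcal{A},P)$ over $\alpha_1$: - For a word $w$, $w^-$ is the word in the opposite order, and $Q_w$ denotes the phrase $Q$ with $|A|$ replaced by $-|A|$ for each letter $A$ occurring exactly once in $w$. - A state is a map $s=\mathrm{mark}:\mathcal{A}\to\{-1,1\}$. Phrases over $\alpha_1$ with a state are considered up to cyclic shifts of components (projections unchanged), permutations of components (projections unchanged), and inversions of a component (replace $w_i$ by $w_i^-$ and $|A|$ by $-|A|$ for each letter occurring exactly once in $w_i$); markers are unchanged. Using these, a letter $A$ is deleted by $w_1|\cdots|AxAy|\cdots|w_k\to w_1|\cdots|x|y|\cdots|w_k$ if $\mathrm{mark}(A)=|A|$, and $\to(w_1|\cdots|x^-y|\cdots|w_k)_x$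 if $\mathrm{mark}(A)=-|A|$; $w_1|\cdots|Ax|Ay|\cdots|w_k\to w_1|\cdots|xy|\cdots|w_k$ if $\mathrm{mark}(A)=|A|$, and $\to(w_1|\cdots|x^-y|\cdots|w_k)_x$ if $\mathrm{mark}(A)=-|A|$. Deleting all letters gives $\emptyset|\cdots|\emptyset$, whose number of components is $|s|$ (independent of the order of deletion). - $\sigma(s)=\#\{A:\mathrm{mark}(A)=1\}-\#\{A:\mathrm{mark}(A)=-1\}$, $w(P)=\sum_{A\in\mathcal{A}}|A|$, and $$J(P)=(-t)^{-3w(P)}\sum_{s}t^{\sigma(s)}(-t^2-t^{-2})^{|s|-1}\in\mathbb{Z}[t,t^{-1}].$$ *)

theory Defs
  imports Main "HOL-Library.FuncSet" "HOL-Library.Multiset" "HOL-Library.Poly_Mapping"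
begin

section \<open>Nanophrases\<close>

text \<open>The projection is a total function; only its values on the alphabet matter.\<close>

datatype ('l, 'a) phrase =
  Phrase (letters: "'l set") (proj: "'l \<Rightarrow> 'a") (comps: "'l list list")

definition nanophrase :: "'a set \<Rightarrow> ('l, 'a) phrase \<Rightarrow> bool" where
  "nanophrase \<alpha> P \<longleftrightarrow>
     finite (letters P) \<and> proj P ` letters P \<subseteq> \<alpha> \<and> 1 \<le> length (comps P) \<and>
     set (concat (comps P)) \<subseteq> letters P \<and>
     (\<forall>A \<in> letters P. count_list (concat (comps P)) A = 2)"

definition isomorphic :: "('l, 'a) phrase \<Rightarrow> ('l, 'a) phrase \<Rightarrow> bool" where
  "isomorphic P P' \<longleftrightarrow> (\<exists>f. bij_betw f (letters P) (letters P') \<and>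
     (\<forall>A \<in> letters P. proj P' (f A) = proj P A) \<and>
     comps P' = map (map f) (comps P))"

section \<open>Homotopy\<close>

definition involution_on :: "'a set \<Rightarrow> ('a \<Rightarrow> 'a) \<Rightarrow> bool" where
  "involution_on \<alpha> \<tau> \<longleftrightarrow> (\<forall>a \<in> \<alpha>. \<tau> a \<in> \<alpha> \<and> \<tau> (\<tau> a) = a)"

text \<open>The components written as one word, with \<^const>\<open>None\<close> for the separator. It is injective
  on nonempty lists of components.\<close>

fun barred :: "'l list list \<Rightarrow> 'l option list" where
  "barred [] = []"
| "barred [w] = map Some w"
| "barred (w # v # ws) = map Some w @ None # barred (v # ws)"

text \<open>In each move the displayed letters are pairwise distinct and do not occur in \<open>x, y, z, t\<close>,
  because a letter of a nanophrase occurs exactly twice.\<close>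

inductive homotopy_move ::
  "'a set \<Rightarrow> ('a \<Rightarrow> 'a) \<Rightarrow> ('a \<times> 'a \<times> 'a) set \<Rightarrow> ('l, 'a) phrase \<Rightarrow> ('l, 'a) phrase \<Rightarrow> bool"
  for \<alpha> \<tau> S where
  iso: "\<lbrakk>nanophrase \<alpha> P; nanophrase \<alpha> P'; isomorphic P P'\<rbrakk> \<Longrightarrow> homotopy_move \<alpha> \<tau> S P P'"
| H1: "\<lbrakk>nanophrase \<alpha> (Phrase X p v); nanophrase \<alpha> (Phrase (X - {A}) p v');
        barred v = x @ [Some A, Some A] @ y;
        barred v' = x @ y\<rbrakk>
       \<Longrightarrow> homotopy_move \<alpha> \<tau> S (Phrase X p v) (Phrase (X - {A}) p v')"
| H2: "\<lbrakk>nanophrase \<alpha> (Phrase X p v); nanophrase \<alpha> (Phrase (X - {A, B}) p v');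
        \<tau> (p A) = p B;
        barred v = x @ [Some A, Some B] @ y @ [Some B, Some A] @ z;
        barred v' = x @ y @ z\<rbrakk>
       \<Longrightarrow> homotopy_move \<alpha> \<tau> S (Phrase X p v) (Phrase (X - {A, B}) p v')"
| H3: "\<lbrakk>nanophrase \<alpha> (Phrase X p v); nanophrase \<alpha> (Phrase X p v');
        (p A, p B, p C) \<in> S;
        barred v = x @ [Some A, Some B] @ y @ [Some A, Some C] @ z @ [Some B, Some C] @ t;
        barred v' = x @ [Some B, Some A] @ y @ [Some C, Some A] @ z @ [Some C, Some B] @ t\<rbrakk>
       \<Longrightarrow> homotopy_move \<alpha> \<tau> S (Phrase X p v) (Phrase X p v')"

definition homotopic ::
  "'a set \<Rightarrow> ('a \<Rightarrow> 'a) \<Rightarrow> ('a \<times> 'a \<times> 'a) set \<Rightarrow> ('l, 'a) phrase \<Rightarrow> ('l, 'a) phrase \<Rightarrow> bool" where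
  "homotopic \<alpha> \<tau> S = equivclp (homotopy_move \<alpha> \<tau> S)"

definition diagonal :: "'a set \<Rightarrow> ('a \<times> 'a \<times> 'a) set" where
  "diagonal \<alpha> = {(a, a, a) | a. a \<in> \<alpha>}"

section \<open>The map to nanophrases over a two-letter alphabet\<close>

definition orbit_of :: "('a \<Rightarrow> 'a) \<Rightarrow> 'a \<Rightarrow> 'a set" where
  "orbit_of \<tau> a = {a, \<tau> a}"

definition free_orbit :: "'a set \<Rightarrow> bool" where
  "free_orbit X \<longleftrightarrow> card X = 2"

definition complete_reps :: "'a set \<Rightarrow> ('a \<Rightarrow> 'a) \<Rightarrow> 'a set \<Rightarrow> bool" where
  "complete_reps \<alpha> \<tau> C \<longleftrightarrow> C \<subseteq> \<alpha> \<and> (\<forall>X \<in> orbit_of \<tau> ` \<alpha>. \<exists>!c. c \<in> C \<and> c \<in> X)"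

definition sign_L :: "('a \<Rightarrow> 'a) \<Rightarrow> 'a set \<Rightarrow> 'a \<Rightarrow> int" where
  "sign_L \<tau> L a =
     (if a \<in> L \<and> free_orbit (orbit_of \<tau> a) then 1
      else if a \<in> \<tau> ` L \<and> free_orbit (orbit_of \<tau> a) then - 1
      else 0)"

datatype alpha0 = a0 | b0

definition U_L :: "('a \<Rightarrow> 'a) \<Rightarrow> 'a set \<Rightarrow> ('l, 'a) phrase \<Rightarrow> ('l, alpha0) phrase" where
  "U_L \<tau> L P = Phrase
     {A \<in> letters P. sign_L \<tau> L (proj P A) \<noteq> 0}
     (\<lambda>A. if sign_L \<tau> L (proj P A) = 1 then a0 else b0)
     (map (filter (\<lambda>A. sign_L \<tau> L (proj P A) \<noteq> 0)) (comps P))"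

section \<open>The Jones polynomial\<close>

text \<open>Phrases over \<open>{1, -1}\<close> are phrases with integer projections.\<close>

fun alpha0_sign :: "alpha0 \<Rightarrow> int" where
  "alpha0_sign a0 = 1"
| "alpha0_sign b0 = - 1"

definition to_signs :: "('l, alpha0) phrase \<Rightarrow> ('l, int) phrase" where
  "to_signs P = Phrase (letters P) (alpha0_sign \<circ> proj P) (comps P)"

definition flip_once :: "'l list \<Rightarrow> ('l \<Rightarrow> int) \<Rightarrow> 'l \<Rightarrow> int" where
  "flip_once w p = (\<lambda>A. if count_list w A = 1 then - p A else p A)"

text \<open>One step rewrites a projection together with the list of components. The first three rules
  generate the identifications of phrases with a state (each is reversible), the last four delete
  a letter.\<close>

inductive state_step ::
  "('l \<Rightarrow> int) \<Rightarrow> ('l \<Rightarrow> int) \<times> 'l list list \<Rightarrow> ('l \<Rightarrow> int) \<times> 'l list list \<Rightarrow> bool"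
  for mark where
  shift: "state_step mark (p, us @ [x @ y] @ vs) (p, us @ [y @ x] @ vs)"
| permute: "mset ws = mset ws' \<Longrightarrow> state_step mark (p, ws) (p, ws')"
| invert: "state_step mark (p, us @ [w] @ vs) (flip_once w p, us @ [rev w] @ vs)"
| delete_same_eq: "mark A = p A \<Longrightarrow>
    state_step mark (p, us @ [[A] @ x @ [A] @ y] @ vs) (p, us @ [x, y] @ vs)"
| delete_same_neg: "mark A = - p A \<Longrightarrow>
    state_step mark (p, us @ [[A] @ x @ [A] @ y] @ vs) (flip_once x p, us @ [rev x @ y] @ vs)"
| delete_diff_eq: "mark A = p A \<Longrightarrow>
    state_step mark (p, us @ [[A] @ x, [A] @ y] @ vs) (p, us @ [x @ y] @ vs)"
| delete_diff_neg: "mark A = - p A \<Longrightarrow>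
    state_step mark (p, us @ [[A] @ x, [A] @ y] @ vs) (flip_once x p, us @ [rev x @ y] @ vs)"

definition state_comps :: "('l, int) phrase \<Rightarrow> ('l \<Rightarrow> int) \<Rightarrow> nat" where
  "state_comps P mark =
     (THE n. \<exists>q. (state_step mark)\<^sup>*\<^sup>* (proj P, comps P) (q, replicate n []))"

definition state_sigma :: "('l, int) phrase \<Rightarrow> ('l \<Rightarrow> int) \<Rightarrow> int" where
  "state_sigma P mark =
     int (card {A \<in> letters P. mark A = 1}) - int (card {A \<in> letters P. mark A = - 1})"

definition writhe :: "('l, int) phrase \<Rightarrow> int" where
  "writhe P = (\<Sum>A \<in> letters P. proj P A)"

text \<open>Integer Laurent polynomials in \<open>t\<close> are the finitely supported functions from exponents to
  coefficients, with convolution as product.\<close>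

type_synonym laurent = "int \<Rightarrow>\<^sub>0 int"

definition t_pow :: "int \<Rightarrow> laurent" where
  "t_pow n = Poly_Mapping.single n 1"

text \<open>Integer powers of the unit \<open>-t\<close>, whose inverse is \<open>-t\<^sup>-\<^sup>1\<close>.\<close>

definition neg_t_pow :: "int \<Rightarrow> laurent" where
  "neg_t_pow n = (if 0 \<le> n then (- t_pow 1) ^ nat n else (- t_pow (- 1)) ^ nat (- n))"

definition jones :: "('l, int) phrase \<Rightarrow> laurent" where
  "jones P = neg_t_pow (- 3 * writhe P) *
     (\<Sum>s \<in> letters P \<rightarrow>\<^sub>E {- 1, 1}.
        t_pow (state_sigma P s) * (- t_pow 2 - t_pow (- 2)) ^ (state_comps P s - 1))"

end

theory Submission
  imports Defs Complex_Main "HOL-Combinatorics.Transposition"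
begin

text \<open>The Jones polynomial is a normalised state sum, the \<open>bracket\<close> below. Its invariance is Kauffman's
argument: smoothing one letter \<open>A\<close> in both ways expresses a bracket by two brackets with one letter
less (\<open>bracket_skein\<close>), and repeated expansion shows that a letter occurring as \<open>AA\<close> contributes
the unit that the writhe factor cancels (\<open>bracket_curl\<close>), that two letters of opposite signs whose
occurrences are adjacent twice cancel (the four lemmas \<open>bracket_R2\<close>), and that the third move
changes nothing. For the third move only the letter \<open>A\<close> is smoothed. One smoothing turns both sides
into phrases which differ by exchanging the names of \<open>B\<close> and \<open>C\<close>; their signs agree because
the move is restricted to the diagonal. After the other smoothing \<open>B\<close> and \<open>C\<close> cancel, and both
sides leave the same phrase (\<open>triangle_reduction\<close>).

What makes the expansion legitimate is that the number of circles of a state does not depend on the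
order of the deletions. This is proved by a closed formula for \<open>2 ^ |s|\<close>. Put a real \<open>2 \<times> 2\<close> matrix
unit in the place of each occurrence of a letter, the same at both occurrences or transposed to
each other depending on the mark, multiply along each component, take traces, and sum over all
choices. Summing over the matrix unit of one letter contracts it exactly as a deletion prescribes,
by the identities \<open>\<Sum> tr (E X E\<^sup>T Y) = tr X tr Y\<close>, \<open>\<Sum> tr (E X E Y) = tr (X\<^sup>T Y)\<close> and their
analogues for two traces, and an empty component has trace \<open>2\<close>. To avoid choosing which occurrence
carries the transposed matrix, the sum over matrix units is rewritten in a basis of symmetric and
skew-symmetric matrices, on which transposition acts by a sign. Reading a component backwards
transposes its product, so it multiplies a summand by the signs of the letters that occur once in
the component; this is why inverting a component has to change the projection of exactly these
letters.

Finally, the map to two letters carries each move to the same move or to the identity: the sign of a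
letter depends only on its projection, and \<open>\<tau>\<close> negates it.\<close>

section \<open>Two-by-two matrices and contraction identities\<close>

type_synonym mat2 = "real \<times> real \<times> real \<times> real"

fun mmul :: "mat2 \<Rightarrow> mat2 \<Rightarrow> mat2" where
  "mmul (a, b, c, d) (a', b', c', d') =
     (a * a' + b * c', a * b' + b * d', c * a' + d * c', c * b' + d * d')"

fun mtr :: "mat2 \<Rightarrow> real" where
  "mtr (a, b, c, d) = a + d"

fun mtransp :: "mat2 \<Rightarrow> mat2" where
  "mtransp (a, b, c, d) = (a, c, b, d)"

fun mscale :: "real \<Rightarrow> mat2 \<Rightarrow> mat2" where
  "mscale k (a, b, c, d) = (k * a, k * b, k * c, k * d)"

lemma mmul_assoc: "mmul (mmul L M) N = mmul L (mmul M N)"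
  by (cases L; cases M; cases N) (simp add: algebra_simps)

lemma mmul_one [simp]: "mmul (1, 0, 0, 1) M = M" "mmul M (1, 0, 0, 1) = M"
  by (cases M; simp)+

lemma mtr_commute: "mtr (mmul M N) = mtr (mmul N M)"
  by (cases M; cases N) (simp add: algebra_simps)

lemma mtr_transp [simp]: "mtr (mtransp M) = mtr M"
  by (cases M) simp

lemma mtransp_mul: "mtransp (mmul M N) = mmul (mtransp N) (mtransp M)"
  by (cases M; cases N) (simp add: algebra_simps)

lemma mscale_mul:
  "mmul (mscale k M) N = mscale k (mmul M N)" "mmul M (mscale k N) = mscale k (mmul M N)"
  "mscale k (mscale l M) = mscale (k * l) M" "mtr (mscale k M) = k * mtr M" "mscale 1 M = M"
  by (cases M; cases N; simp add: algebra_simps)+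

text \<open>An orthogonal basis of the \<open>2 \<times> 2\<close> matrices in which every element is symmetric or
skew-symmetric; only \<open>PK\<close> is skew.\<close>

datatype pauli = P1 | PX | PZ | PK

lemma UNIV_pauli: "UNIV = {P1, PX, PZ, PK}"
  using pauli.exhaust by blast

fun basis_mat :: "pauli \<Rightarrow> mat2" where
  "basis_mat P1 = (1, 0, 0, 1)"
| "basis_mat PX = (0, 1, 1, 0)"
| "basis_mat PZ = (1, 0, 0, - 1)"
| "basis_mat PK = (0, 1, - 1, 0)"

definition transp_sign :: "pauli \<Rightarrow> real" where
  "transp_sign \<mu> = (if \<mu> = PK then - 1 else 1)"

text \<open>The coefficients of \<open>\<mu> \<otimes> \<mu>\<close> in \<open>\<Sum> E \<otimes> E\<^sup>T\<close> (first case) and in \<open>\<Sum> E \<otimes> E\<close> (second case),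
where \<open>E\<close> runs through the four matrix units.\<close>

definition wick_weight :: "bool \<Rightarrow> pauli \<Rightarrow> real" where
  "wick_weight orient \<mu> = (if orient then transp_sign \<mu> else 1) / 2"

lemma transp_sign_sq [simp]: "transp_sign \<mu> * transp_sign \<mu> = 1"
  by (simp add: transp_sign_def)

lemma wick_weight_not: "wick_weight (\<not> b) \<mu> = wick_weight b \<mu> * transp_sign \<mu>"
  by (simp add: wick_weight_def transp_sign_def)

lemma mtransp_basis_mat: "mtransp (basis_mat \<mu>) = mscale (transp_sign \<mu>) (basis_mat \<mu>)"
  by (cases \<mu>) (simp_all add: transp_sign_def)

text \<open>The two contractions of a pair of equal letters inside one trace. With matrix units they read
\<open>\<Sum> X\<^sub>o\<^sub>o Y\<^sub>i\<^sub>i\<close> and \<open>\<Sum> X\<^sub>o\<^sub>i Y\<^sub>o\<^sub>i\<close>.\<close>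

lemma wick_same:
  "(\<Sum>\<mu>\<in>UNIV. wick_weight True \<mu> * mtr (mmul (basis_mat \<mu>) (mmul M (mmul (basis_mat \<mu>) N)))) = mtr M * mtr N"
  "(\<Sum>\<mu>\<in>UNIV. wick_weight False \<mu> * mtr (mmul (basis_mat \<mu>) (mmul M (mmul (basis_mat \<mu>) N)))) = mtr (mmul (mtransp M) N)"
  by (cases M; cases N; simp add: UNIV_pauli wick_weight_def transp_sign_def field_simps)+

text \<open>The contractions of a pair of equal letters in two different traces merge the traces.\<close>

lemma wick_diff:
  "(\<Sum>\<mu>\<in>UNIV. wick_weight True \<mu> * (mtr (mmul (basis_mat \<mu>) M) * mtr (mmul (basis_mat \<mu>) N))) = mtr (mmul M N)"
  "(\<Sum>\<mu>\<in>UNIV. wick_weight False \<mu> * (mtr (mmul (basis_mat \<mu>) M) * mtr (mmul (basis_mat \<mu>) N))) = mtr (mmul (mtransp M) N)"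
  by (cases M; cases N; simp add: UNIV_pauli wick_weight_def transp_sign_def field_simps)+

fun word_mat :: "('l \<Rightarrow> pauli) \<Rightarrow> 'l list \<Rightarrow> mat2" where
  "word_mat g [] = (1, 0, 0, 1)"
| "word_mat g (A # w) = mmul (basis_mat (g A)) (word_mat g w)"

lemma word_mat_append: "word_mat g (u @ v) = mmul (word_mat g u) (word_mat g v)"
  by (induction u) (simp_all add: mmul_assoc)

text \<open>Transposing a product reverses it, and each factor contributes its sign under transposition.\<close>

lemma mtransp_word_mat: "mtransp (word_mat g w) = mscale (\<Prod>A\<leftarrow>w. transp_sign (g A)) (word_mat g (rev w))"
  by (induction w) (simp_all add: word_mat_append mtransp_mul mtransp_basis_mat mscale_mul mult.commute)

lemma word_mat_cong: "(\<And>A. A \<in> set w \<Longrightarrow> g A = h A) \<Longrightarrow> word_mat g w = word_mat h w"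
  by (induction w) auto

lemma word_mat_map: "word_mat g (map f w) = word_mat (g \<circ> f) w"
  by (induction w) auto

section \<open>Counting the circles of a state by a sum of traces\<close>

text \<open>This is the Gauss word condition for a phrase whose alphabet is the set of its letters; it
survives every deletion.\<close>

definition gauss :: "'l list list \<Rightarrow> bool" where
  "gauss ws \<longleftrightarrow> (\<forall>A. count_list (concat ws) A = 0 \<or> count_list (concat ws) A = 2)"

definition sign_valued :: "('l \<Rightarrow> int) \<Rightarrow> bool" where
  "sign_valued p \<longleftrightarrow> (\<forall>A. p A = 1 \<or> p A = - 1)"

text \<open>The closed formula for two to the power of the number of circles. Both occurrences of a letter
carry the same basis matrix, so the formula needs no numbering of the occurrences.\<close>

definition loop_sum :: "('l \<Rightarrow> int) \<Rightarrow> ('l \<Rightarrow> int) \<Rightarrow> 'l list list \<Rightarrow> real" where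
  "loop_sum mark p ws = (\<Sum>g \<in> set (concat ws) \<rightarrow>\<^sub>E UNIV.
     (\<Prod>A\<in>set (concat ws). wick_weight (mark A = p A) (g A)) * (\<Prod>w\<leftarrow>ws. mtr (word_mat g w)))"

lemma sign_valued_flip [simp]: "sign_valued p \<Longrightarrow> sign_valued (flip_once w p)"
  unfolding sign_valued_def flip_once_def by force

lemma prod_list_count:
  assumes "finite X" "set w \<subseteq> X"
  shows "(\<Prod>A\<leftarrow>w. f A) = (\<Prod>A\<in>X. f A ^ count_list w A :: real)"
  using assms(2)
proof (induction w)
  case (Cons a w)
  have "(\<Prod>A\<in>X. f A ^ count_list (a # w) A) = (\<Prod>A\<in>X. (if A = a then f A else 1) * f A ^ count_list w A)"
    by (rule prod.cong) auto
  also have "\<dots> = f a * (\<Prod>A\<in>X. f A ^ count_list w A)"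
    using Cons.prems assms(1) by (simp add: prod.distrib)
  finally show ?case using Cons by simp
qed simp

text \<open>Changing the projection of a letter exchanges its two smoothings, hence multiplies its weight by
the sign under transposition. For a letter occurring twice in \<open>w\<close> the two signs on the right
cancel.\<close>

lemma wick_weight_flip:
  assumes "finite X" "set w \<subseteq> X" "\<And>A. count_list w A \<le> 2" "sign_valued p"
    and "\<And>A. A \<in> X \<Longrightarrow> mark A = 1 \<or> mark A = (-1::int)"
  shows "(\<Prod>A\<in>X. wick_weight (mark A = flip_once w p A) (g A)) =
         (\<Prod>A\<in>X. wick_weight (mark A = p A) (g A)) * (\<Prod>A\<leftarrow>w. transp_sign (g A))"
proof -
  have "(\<Prod>A\<leftarrow>w. transp_sign (g A)) = (\<Prod>A\<in>X. transp_sign (g A) ^ count_list w A)"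
    by (rule prod_list_count[OF assms(1,2)])
  moreover have "wick_weight (mark A = flip_once w p A) (g A) =
      wick_weight (mark A = p A) (g A) * transp_sign (g A) ^ count_list w A" if "A \<in> X" for A
  proof -
    have "(mark A = - p A) = (\<not> mark A = p A)"
      using assms(4,5) that unfolding sign_valued_def by (metis add.inverse_inverse zero_neq_one one_neq_neg_one)
    moreover have "count_list w A = 0 \<or> count_list w A = 1 \<or> count_list w A = 2"
      using assms(3)[of A] by linarith
    ultimately show ?thesis
      by (auto simp: flip_once_def wick_weight_not power2_eq_square)
  qed
  ultimately show ?thesis by (simp add: prod.distrib)
qed

lemma sum_PiE_insert:
  assumes "x \<notin> S"
  shows "(\<Sum>g \<in> insert x S \<rightarrow>\<^sub>E T. F g) = (\<Sum>g \<in> S \<rightarrow>\<^sub>E T. \<Sum>t\<in>T. F (g(x := t)))"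
proof -
  have "(\<Sum>g \<in> insert x S \<rightarrow>\<^sub>E T. F g) = (\<Sum>(t, g) \<in> T \<times> (S \<rightarrow>\<^sub>E T). F (g(x := t)))"
    unfolding PiE_insert_eq using inj_combinator[OF assms, of "\<lambda>_. T"]
    by (subst sum.reindex) (auto simp: case_prod_unfold)
  also have "\<dots> = (\<Sum>t\<in>T. \<Sum>g \<in> S \<rightarrow>\<^sub>E T. F (g(x := t)))"
    by (rule sum.cartesian_product[symmetric])
  finally show ?thesis by (simp add: sum.swap[of _ T])
qed

lemma gauss_count_le: "gauss (us @ w # vs) \<Longrightarrow> count_list w A \<le> 2"
  using spec[of _ A] unfolding gauss_def
  by (metis (no_types, opaque_lifting) concat.simps(2) concat_append count_list_append le_add1 le_add2 le_trans order_refl zero_le)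

lemma loop_sum_perm:
  assumes "mset ws = mset ws'"
  shows "loop_sum mark p ws = loop_sum mark p ws'"
proof -
  have "set (concat ws) = set (concat ws')"
    by (simp add: mset_eq_setD[OF assms])
  moreover have "(\<Prod>w\<leftarrow>ws. mtr (word_mat g w)) = (\<Prod>w\<leftarrow>ws'. mtr (word_mat g w))" for g
    by (metis assms mset_map prod_mset_prod_list)
  ultimately show ?thesis by (simp add: loop_sum_def)
qed

lemma loop_sum_shift:
  "loop_sum mark p (us @ (x @ y) # vs) = loop_sum mark p (us @ (y @ x) # vs)"
proof -
  have "set (concat (us @ (x @ y) # vs)) = set (concat (us @ (y @ x) # vs))" by auto
  moreover have "mtr (word_mat g (x @ y)) = mtr (word_mat g (y @ x))" for g
    by (metis word_mat_append mtr_commute)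
  ultimately show ?thesis by (simp add: loop_sum_def)
qed

text \<open>The signs from transposing the trace of \<open>w\<close> are absorbed by the change of the projection,
summand by summand.\<close>

lemma loop_sum_invert:
  assumes "gauss (us @ w # vs)" "sign_valued p"
    and m: "\<And>A. A \<in> set (concat (us @ w # vs)) \<Longrightarrow> mark A = 1 \<or> mark A = -1"
  shows "loop_sum mark (flip_once w p) (us @ rev w # vs) = loop_sum mark p (us @ w # vs)"
proof -
  define X where "X = set (concat (us @ w # vs))"
  have X: "set (concat (us @ rev w # vs)) = X" unfolding X_def by auto
  have fin: "finite X" "set w \<subseteq> X" unfolding X_def by auto
  have e: "(\<Prod>A\<leftarrow>w. transp_sign (g A)) * mtr (word_mat g (rev w)) = mtr (word_mat g w)" for g
    by (metis mscale_mul(4) mtr_transp mtransp_word_mat)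
  have "(\<Prod>A\<in>X. wick_weight (mark A = flip_once w p A) (g A)) =
         (\<Prod>A\<in>X. wick_weight (mark A = p A) (g A)) * (\<Prod>A\<leftarrow>w. transp_sign (g A))" for g
    using wick_weight_flip[OF fin _ assms(2), of mark g] gauss_count_le[OF assms(1)] m unfolding X_def by blast
  then show ?thesis unfolding loop_sum_def X X_def[symmetric]
    by (intro sum.cong refl) (simp add: e[symmetric] mult_ac)
qed

text \<open>The sum over the matrix of the deleted letter can be carried out first.\<close>

lemma loop_sum_delete:
  assumes A: "A \<notin> set (concat ws')" "set (concat ws) = insert A (set (concat ws'))"
    and T: "\<And>g. (\<Sum>\<mu>\<in>UNIV. wick_weight (mark A = p A) \<mu> * (\<Prod>w\<leftarrow>ws. mtr (word_mat (g(A := \<mu>)) w))) *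
        (\<Prod>B\<in>set (concat ws'). wick_weight (mark B = p B) (g B)) =
        (\<Prod>B\<in>set (concat ws'). wick_weight (mark B = p' B) (g B)) * (\<Prod>w\<leftarrow>ws'. mtr (word_mat g w))"
  shows "loop_sum mark p' ws' = loop_sum mark p ws"
proof -
  let ?X = "set (concat ws')"
  have *: "(\<Prod>B\<in>?X. wick_weight (mark B = p B) (if B = A then \<mu> else g B)) =
      (\<Prod>B\<in>?X. wick_weight (mark B = p B) (g B))" for g \<mu>
    by (rule prod.cong) (use A in auto)
  have "loop_sum mark p ws = (\<Sum>g\<in>?X \<rightarrow>\<^sub>E UNIV. \<Sum>\<mu>\<in>UNIV.
      wick_weight (mark A = p A) \<mu> * (\<Prod>B\<in>?X. wick_weight (mark B = p B) (g B)) * (\<Prod>w\<leftarrow>ws. mtr (word_mat (g(A := \<mu>)) w)))"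
    unfolding loop_sum_def A(2) sum_PiE_insert[OF A(1)]
    using A(1) by (intro sum.cong refl) (simp add: * del: set_concat)
  also have "\<dots> = (\<Sum>g\<in>?X \<rightarrow>\<^sub>E UNIV.
      (\<Sum>\<mu>\<in>UNIV. wick_weight (mark A = p A) \<mu> * (\<Prod>w\<leftarrow>ws. mtr (word_mat (g(A := \<mu>)) w))) *
      (\<Prod>B\<in>?X. wick_weight (mark B = p B) (g B)))"
    unfolding sum_distrib_right by (intro sum.cong refl) (simp only: mult_ac)
  also have "\<dots> = loop_sum mark p' ws'"
    unfolding loop_sum_def T ..
  finally show ?thesis by simp
qed

lemma word_mat_upd [simp]: "A \<notin> set w \<Longrightarrow> word_mat (g(A := \<mu>)) w = word_mat g w"
  by (rule word_mat_cong) auto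

lemma traces_upd [simp]:
  "A \<notin> set (concat ws) \<Longrightarrow> (\<Prod>w\<leftarrow>ws. mtr (word_mat (g(A := \<mu>)) w)) = (\<Prod>w\<leftarrow>ws. mtr (word_mat g w))"
  by (induction ws) auto

lemma sum_middle: "(\<Sum>\<mu>\<in>U. f \<mu> * (a * (h \<mu> * b))) = a * b * (\<Sum>\<mu>\<in>U. f \<mu> * h \<mu> :: real)"
  by (simp add: sum_distrib_left mult_ac)

lemma sum_middle2: "(\<Sum>\<mu>\<in>U. f \<mu> * (a * (h \<mu> * (k \<mu> * b)))) = a * b * (\<Sum>\<mu>\<in>U. f \<mu> * (h \<mu> * k \<mu>) :: real)"
  by (simp add: sum_distrib_left mult_ac)

lemma mtr_transp_word_mat:
  "mtr (mmul (mtransp (word_mat g x)) (word_mat g y)) = (\<Prod>A\<leftarrow>x. transp_sign (g A)) * mtr (word_mat g (rev x @ y))"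
  by (simp add: mtransp_word_mat mscale_mul word_mat_append)

lemma gauss_fresh_same:
  assumes "gauss (us @ [[A] @ x @ [A] @ y] @ vs)"
  shows "A \<notin> set x" "A \<notin> set y" "A \<notin> set (concat us)" "A \<notin> set (concat vs)"
  using spec[OF assms[unfolded gauss_def], of A] by (auto simp del: set_concat simp flip: count_list_0_iff)

lemma gauss_fresh_diff:
  assumes "gauss (us @ [[A] @ x, [A] @ y] @ vs)"
  shows "A \<notin> set x" "A \<notin> set y" "A \<notin> set (concat us)" "A \<notin> set (concat vs)"
  using spec[OF assms[unfolded gauss_def], of A] by (auto simp del: set_concat simp flip: count_list_0_iff)

lemma gauss_fresh_mono:
  assumes "gauss ws" "\<And>B. B \<noteq> A \<Longrightarrow> count_list (concat ws') B = count_list (concat ws) B"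
    "A \<notin> set (concat ws')"
  shows "gauss ws'"
  using assms unfolding gauss_def by (metis count_list_0_iff)

lemma gauss_same:
  assumes "gauss (us @ [[A] @ x @ [A] @ y] @ vs)"
  shows "gauss (us @ [x, y] @ vs)" "gauss (us @ [rev x @ y] @ vs)"
  by (rule gauss_fresh_mono[OF assms, of A]; use gauss_fresh_same[OF assms] in \<open>simp add: count_list_rev\<close>)+

lemma gauss_diff:
  assumes "gauss (us @ [[A] @ x, [A] @ y] @ vs)"
  shows "gauss (us @ [x @ y] @ vs)" "gauss (us @ [rev x @ y] @ vs)"
  by (rule gauss_fresh_mono[OF assms, of A]; use gauss_fresh_diff[OF assms] in \<open>simp add: count_list_rev\<close>)+

text \<open>Here and for two components, the transposed matrix of \<open>x\<close> produced by the contraction is the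
matrix of \<open>rev x\<close> up to signs, which are those of the changed projection.\<close>

lemma loop_sum_delete_same:
  assumes d: "gauss (us @ [[A] @ x @ [A] @ y] @ vs)" and s: "sign_valued p"
    and m: "\<And>B. B \<in> set (concat (us @ [[A] @ x @ [A] @ y] @ vs)) \<Longrightarrow> mark B = 1 \<or> mark B = -1"
  shows "mark A = p A \<Longrightarrow>
      loop_sum mark p (us @ [x, y] @ vs) = loop_sum mark p (us @ [[A] @ x @ [A] @ y] @ vs)"
    and "mark A = - p A \<Longrightarrow> loop_sum mark (flip_once x p) (us @ [rev x @ y] @ vs) =
      loop_sum mark p (us @ [[A] @ x @ [A] @ y] @ vs)"
proof -
  note f = gauss_fresh_same[OF d]
  let ?ws = "us @ [[A] @ x @ [A] @ y] @ vs"
  show "loop_sum mark p (us @ [x, y] @ vs) = loop_sum mark p ?ws" if "mark A = p A"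
  proof (rule loop_sum_delete[of A])
    fix g
    show "(\<Sum>\<mu>\<in>UNIV. wick_weight (mark A = p A) \<mu> * (\<Prod>w\<leftarrow>?ws. mtr (word_mat (g(A := \<mu>)) w))) *
        (\<Prod>B\<in>set (concat (us @ [x, y] @ vs)). wick_weight (mark B = p B) (g B)) =
        (\<Prod>B\<in>set (concat (us @ [x, y] @ vs)). wick_weight (mark B = p B) (g B)) *
        (\<Prod>w\<leftarrow>us @ [x, y] @ vs. mtr (word_mat g w))"
      using f that by (simp add: word_mat_append sum_middle wick_same del: set_concat)
  qed (use f in auto)
  show "loop_sum mark (flip_once x p) (us @ [rev x @ y] @ vs) = loop_sum mark p ?ws"
    if mA: "mark A = - p A"
  proof (rule loop_sum_delete[of A])
    fix g
    have "\<not> mark A = p A" using mA s unfolding sign_valued_def by (metis add.inverse_inverse one_neq_neg_one)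
    moreover have "count_list x B \<le> 2" for B
      using gauss_count_le[of us "rev x @ y" vs B] gauss_same(2)[OF d] by (simp add: count_list_rev)
    then have "(\<Prod>B\<in>set (concat (us @ [rev x @ y] @ vs)). wick_weight (mark B = flip_once x p B) (g B)) =
      (\<Prod>B\<in>set (concat (us @ [rev x @ y] @ vs)). wick_weight (mark B = p B) (g B)) * (\<Prod>A\<leftarrow>x. transp_sign (g A))"
      by (intro wick_weight_flip[OF finite_set _ _ s]) (use m in auto)
    ultimately show "(\<Sum>\<mu>\<in>UNIV. wick_weight (mark A = p A) \<mu> * (\<Prod>w\<leftarrow>?ws. mtr (word_mat (g(A := \<mu>)) w))) *
        (\<Prod>B\<in>set (concat (us @ [rev x @ y] @ vs)). wick_weight (mark B = p B) (g B)) =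
        (\<Prod>B\<in>set (concat (us @ [rev x @ y] @ vs)). wick_weight (mark B = flip_once x p B) (g B)) *
        (\<Prod>w\<leftarrow>us @ [rev x @ y] @ vs. mtr (word_mat g w))"
      using f by (simp add: word_mat_append[of _ x] word_mat_append[of _ _ "_ # _"] sum_middle wick_same
          mtr_transp_word_mat del: set_concat)
  qed (use f in auto)
qed

lemma loop_sum_delete_diff:
  assumes d: "gauss (us @ [[A] @ x, [A] @ y] @ vs)" and s: "sign_valued p"
    and m: "\<And>B. B \<in> set (concat (us @ [[A] @ x, [A] @ y] @ vs)) \<Longrightarrow> mark B = 1 \<or> mark B = -1"
  shows "mark A = p A \<Longrightarrow>
      loop_sum mark p (us @ [x @ y] @ vs) = loop_sum mark p (us @ [[A] @ x, [A] @ y] @ vs)"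
    and "mark A = - p A \<Longrightarrow> loop_sum mark (flip_once x p) (us @ [rev x @ y] @ vs) =
      loop_sum mark p (us @ [[A] @ x, [A] @ y] @ vs)"
proof -
  note f = gauss_fresh_diff[OF d]
  let ?ws = "us @ [[A] @ x, [A] @ y] @ vs"
  show "loop_sum mark p (us @ [x @ y] @ vs) = loop_sum mark p ?ws" if "mark A = p A"
  proof (rule loop_sum_delete[of A])
    fix g
    show "(\<Sum>\<mu>\<in>UNIV. wick_weight (mark A = p A) \<mu> * (\<Prod>w\<leftarrow>?ws. mtr (word_mat (g(A := \<mu>)) w))) *
        (\<Prod>B\<in>set (concat (us @ [x @ y] @ vs)). wick_weight (mark B = p B) (g B)) =
        (\<Prod>B\<in>set (concat (us @ [x @ y] @ vs)). wick_weight (mark B = p B) (g B)) *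
        (\<Prod>w\<leftarrow>us @ [x @ y] @ vs. mtr (word_mat g w))"
      using f that by (simp add: word_mat_append sum_middle2 wick_diff del: set_concat)
  qed (use f in auto)
  show "loop_sum mark (flip_once x p) (us @ [rev x @ y] @ vs) = loop_sum mark p ?ws"
    if mA: "mark A = - p A"
  proof (rule loop_sum_delete[of A])
    fix g
    have "\<not> mark A = p A" using mA s unfolding sign_valued_def by (metis add.inverse_inverse one_neq_neg_one)
    moreover have "count_list x B \<le> 2" for B
      using gauss_count_le[of us "rev x @ y" vs B] gauss_diff(2)[OF d] by (simp add: count_list_rev)
    then have "(\<Prod>B\<in>set (concat (us @ [rev x @ y] @ vs)). wick_weight (mark B = flip_once x p B) (g B)) =
      (\<Prod>B\<in>set (concat (us @ [rev x @ y] @ vs)). wick_weight (mark B = p B) (g B)) * (\<Prod>A\<leftarrow>x. transp_sign (g A))"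
      by (intro wick_weight_flip[OF finite_set _ _ s]) (use m in auto)
    ultimately show "(\<Sum>\<mu>\<in>UNIV. wick_weight (mark A = p A) \<mu> * (\<Prod>w\<leftarrow>?ws. mtr (word_mat (g(A := \<mu>)) w))) *
        (\<Prod>B\<in>set (concat (us @ [rev x @ y] @ vs)). wick_weight (mark B = p B) (g B)) =
        (\<Prod>B\<in>set (concat (us @ [rev x @ y] @ vs)). wick_weight (mark B = flip_once x p B) (g B)) *
        (\<Prod>w\<leftarrow>us @ [rev x @ y] @ vs. mtr (word_mat g w))"
      using f by (simp add: sum_middle2 wick_diff mtr_transp_word_mat del: set_concat)
  qed (use f in auto)
qed

lemma state_step_loop_sum:
  assumes "state_step mark P Q" "gauss (snd P)" "sign_valued (fst P)"
    and "\<And>A. A \<in> set (concat (snd P)) \<Longrightarrow> mark A = 1 \<or> mark A = -1"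
  shows "gauss (snd Q) \<and> sign_valued (fst Q) \<and> set (concat (snd Q)) \<subseteq> set (concat (snd P)) \<and>
    loop_sum mark (fst Q) (snd Q) = loop_sum mark (fst P) (snd P)"
  using assms
proof cases
  case (shift p us x y vs)
  then show ?thesis using assms(2-) loop_sum_shift[of mark p us x y vs] by (auto simp: gauss_def)
next
  case (permute ws ws' p)
  then have "mset (concat ws) = mset (concat ws')" by (simp add: mset_concat flip: sum_mset_sum_list)
  then have "count_list (concat ws) = count_list (concat ws')" by (metis count_mset ext)
  then show ?thesis using permute assms(2-) loop_sum_perm[of ws ws'] mset_eq_setD[of ws ws']
    by (auto simp: gauss_def)
next
  case (invert p us w vs)
  then show ?thesis using assms(2-) loop_sum_invert[of us w vs p mark]
    by (auto simp: gauss_def count_list_rev)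
next
  case (delete_same_eq A p us x y vs)
  then show ?thesis using assms(2-) loop_sum_delete_same(1)[of us A x y vs p mark] gauss_same[of us A x y vs]
    by auto
next
  case (delete_same_neg A p us x y vs)
  then show ?thesis using assms(2-) loop_sum_delete_same(2)[of us A x y vs p mark] gauss_same[of us A x y vs]
    by auto
next
  case (delete_diff_eq A p us x y vs)
  then show ?thesis using assms(2-) loop_sum_delete_diff(1)[of us A x y vs p mark] gauss_diff[of us A x y vs]
    by auto
next
  case (delete_diff_neg A p us x y vs)
  then show ?thesis using assms(2-) loop_sum_delete_diff(2)[of us A x y vs p mark] gauss_diff[of us A x y vs]
    by auto
qed

definition marking_on :: "'l set \<Rightarrow> ('l \<Rightarrow> int) \<Rightarrow> bool" where
  "marking_on X mark \<longleftrightarrow> (\<forall>A\<in>X. mark A = 1 \<or> mark A = - 1)"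

lemma state_steps_loop_sum:
  assumes "(state_step mark)\<^sup>*\<^sup>* P Q" "gauss (snd P)" "sign_valued (fst P)" "marking_on (set (concat (snd P))) mark"
  shows "gauss (snd Q) \<and> sign_valued (fst Q) \<and> set (concat (snd Q)) \<subseteq> set (concat (snd P)) \<and>
    loop_sum mark (fst Q) (snd Q) = loop_sum mark (fst P) (snd P)"
  using assms(1)
proof induction
  case (step Q R)
  then have "mark A = 1 \<or> mark A = -1" if "A \<in> set (concat (snd Q))" for A
    using that assms(4) unfolding marking_on_def by blast
  with state_step_loop_sum[OF step.hyps(2)] step.IH
  have "gauss (snd R) \<and> sign_valued (fst R) \<and> set (concat (snd R)) \<subseteq> set (concat (snd Q)) \<and>
    loop_sum mark (fst R) (snd R) = loop_sum mark (fst Q) (snd Q)" by blast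
  with step.IH show ?case by (metis subset_trans)
qed (use assms in simp)

lemma state_steps_nonempty:
  assumes "(state_step mark)\<^sup>*\<^sup>* P Q" "snd P \<noteq> []"
  shows "snd Q \<noteq> []"
  using assms(1)
proof induction
  case (step Q R)
  from step.hyps(2) step.IH show ?case by cases auto
qed (use assms in simp)

lemma loop_sum_circles: "loop_sum mark p (replicate n []) = 2 ^ n"
  by (simp add: loop_sum_def sum_list_replicate prod_list_replicate)

lemma front_component:
  assumes "w \<in> set ws"
  obtains ws' where "mset ws = mset (w # ws')"
proof -
  obtain us vs where "ws = us @ w # vs" using assms by (meson split_list)
  then show thesis using that[of "us @ vs"] by simp
qed

text \<open>The component beginning with \<open>A\<close> is moved to the front, and the other occurrence of \<open>A\<close> is
brought to the beginning of its component if it lies in another one.\<close>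

lemma reduce_letter:
  assumes d: "gauss ws" and s: "sign_valued p" and w: "A # w \<in> set ws" and m: "mark A = 1 \<or> mark A = (-1::int)"
  shows "\<exists>p' ws'. (state_step mark)\<^sup>*\<^sup>* (p, ws) (p', ws') \<and> length (concat ws') < length (concat ws)"
proof -
  have mp: "mark A = p A \<or> mark A = - p A" using s m unfolding sign_valued_def by (metis add.inverse_inverse)
  obtain ws1 where ws1: "mset ws = mset ((A # w) # ws1)" using front_component[OF w] .
  then have cc: "mset (concat ws) = mset (concat ((A # w) # ws1))"
    by (simp add: mset_concat flip: sum_mset_sum_list)
  have len: "length (concat ws) = length (concat ((A # w) # ws1))" using cc by (rule mset_eq_length)
  have "count_list (concat ws) A = count_list (concat ((A # w) # ws1)) A" using cc by (metis count_mset)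
  then have A2: "count_list w A = 1 \<or> A \<in> set (concat ws1)"
    using spec[OF d[unfolded gauss_def], of A] by (auto simp del: set_concat simp flip: count_list_0_iff)
  have s1: "state_step mark (p, ws) (p, (A # w) # ws1)" by (rule state_step.permute[OF ws1])
  show ?thesis
  proof (cases "A \<in> set w")
    case True
    then obtain x y where xy: "w = x @ A # y" by (meson split_list)
    have "state_step mark (p, (A # w) # ws1) (p, x # y # ws1) \<or>
        state_step mark (p, (A # w) # ws1) (flip_once x p, (rev x @ y) # ws1)"
      using mp state_step.delete_same_eq[of mark A p "[]" x y ws1]
        state_step.delete_same_neg[of mark A p "[]" x y ws1] xy by auto
    moreover have "length (concat (x # y # ws1)) < length (concat ws)"
      "length (concat ((rev x @ y) # ws1)) < length (concat ws)" unfolding len xy by auto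
    ultimately show ?thesis using s1 by (meson converse_rtranclp_into_rtranclp rtranclp.rtrancl_refl)
  next
    case False
    then have "A \<in> set (concat ws1)" using A2 by (metis count_list_0_iff zero_neq_one)
    then obtain v where v: "v \<in> set ws1" "A \<in> set v" by auto
    then obtain y x where xy: "v = y @ A # x" by (meson split_list)
    obtain ws2 where ws2: "mset ws1 = mset (v # ws2)" using front_component[OF v(1)] .
    have s2: "state_step mark (p, (A # w) # ws1) (p, (A # w) # v # ws2)"
      by (rule state_step.permute) (simp add: ws2)
    have s3: "state_step mark (p, (A # w) # v # ws2) (p, (A # w) # (A # x @ y) # ws2)"
      using state_step.shift[of mark p "[A # w]" y "A # x" ws2] xy by simp
    have "mset (concat ws1) = mset (concat (v # ws2))"
      using ws2 by (simp add: mset_concat flip: sum_mset_sum_list)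
    then have len2: "length (concat ws1) = length (concat (v # ws2))" by (rule mset_eq_length)
    have "state_step mark (p, (A # w) # (A # x @ y) # ws2) (p, (w @ x @ y) # ws2) \<or>
        state_step mark (p, (A # w) # (A # x @ y) # ws2) (flip_once w p, (rev w @ x @ y) # ws2)"
      using mp state_step.delete_diff_eq[of mark A p "[]" w "x @ y" ws2]
        state_step.delete_diff_neg[of mark A p "[]" w "x @ y" ws2] by auto
    moreover have "length (concat ((w @ x @ y) # ws2)) < length (concat ws)"
      "length (concat ((rev w @ x @ y) # ws2)) < length (concat ws)"
      using len len2 unfolding xy by auto
    ultimately show ?thesis using s1 s2 s3
      by (meson converse_rtranclp_into_rtranclp rtranclp.rtrancl_refl)
  qed
qed

lemma state_reduces_to_circles:
  assumes "gauss ws" "sign_valued p" "marking_on (set (concat ws)) mark"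
  shows "\<exists>n q. (state_step mark)\<^sup>*\<^sup>* (p, ws) (q, replicate n [])"
  using assms
proof (induction "length (concat ws)" arbitrary: p ws rule: less_induct)
  case less
  show ?case
  proof (cases "\<forall>w\<in>set ws. w = []")
    case True
    then have "ws = replicate (length ws) []" by (metis replicate_eqI)
    then show ?thesis by (metis rtranclp.rtrancl_refl)
  next
    case False
    then obtain A w where w: "A # w \<in> set ws" by (metis neq_Nil_conv)
    then have "mark A = 1 \<or> mark A = -1" using less.prems(3) unfolding marking_on_def by fastforce
    from reduce_letter[of ws p A w mark, OF less.prems(1,2) w this] obtain p' ws' where
      r: "(state_step mark)\<^sup>*\<^sup>* (p, ws) (p', ws')" "length (concat ws') < length (concat ws)" by blast
    have "gauss ws'" "sign_valued p'" "marking_on (set (concat ws')) mark"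
      using state_steps_loop_sum[OF r(1)] less.prems unfolding marking_on_def by auto
    then obtain n q where "(state_step mark)\<^sup>*\<^sup>* (p', ws') (q, replicate n [])"
      using less.hyps[OF r(2)] by blast
    then show ?thesis using r(1) by (metis rtranclp_trans)
  qed
qed

definition loop_count :: "('l \<Rightarrow> int) \<Rightarrow> ('l \<Rightarrow> int) \<Rightarrow> 'l list list \<Rightarrow> nat" where
  "loop_count mark p ws = (THE n. \<exists>q. (state_step mark)\<^sup>*\<^sup>* (p, ws) (q, replicate n []))"

text \<open>A state that reduces to \<open>n\<close> circles has trace sum \<open>2 ^ n\<close>, and reduction preserves this sum;
hence \<open>n\<close> is unique.\<close>

lemma loop_count_reach:
  assumes "gauss ws" "sign_valued p" "marking_on (set (concat ws)) mark"
  shows "\<exists>q. (state_step mark)\<^sup>*\<^sup>* (p, ws) (q, replicate (loop_count mark p ws) [])"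
proof -
  obtain n where n: "\<exists>q. (state_step mark)\<^sup>*\<^sup>* (p, ws) (q, replicate n [])"
    using state_reduces_to_circles[OF assms] by blast
  have u: "2 ^ m = loop_sum mark p ws" if "\<exists>q. (state_step mark)\<^sup>*\<^sup>* (p, ws) (q, replicate m [])" for m
  proof -
    from that obtain q where "(state_step mark)\<^sup>*\<^sup>* (p, ws) (q, replicate m [])" ..
    from state_steps_loop_sum[OF this] assms show ?thesis by (simp add: loop_sum_circles)
  qed
  have "m = n" if "\<exists>q. (state_step mark)\<^sup>*\<^sup>* (p, ws) (q, replicate m [])" for m
    using u[OF that] u[OF n] by (metis one_less_numeral_iff power_inject_exp semiring_norm(76))
  then show ?thesis unfolding loop_count_def
    by (rule theI[where P = "\<lambda>m. \<exists>q. (state_step mark)\<^sup>*\<^sup>* (p, ws) (q, replicate m [])", OF n])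
qed

lemma loop_count_sum:
  assumes "gauss ws" "sign_valued p" "marking_on (set (concat ws)) mark"
  shows "2 ^ loop_count mark p ws = loop_sum mark p ws"
proof -
  obtain q where q: "(state_step mark)\<^sup>*\<^sup>* (p, ws) (q, replicate (loop_count mark p ws) [])"
    using loop_count_reach[OF assms] by blast
  from state_steps_loop_sum[OF q] assms show ?thesis by (simp add: loop_sum_circles)
qed

lemma loop_count_pos:
  assumes "gauss ws" "sign_valued p" "marking_on (set (concat ws)) mark" "ws \<noteq> []"
  shows "loop_count mark p ws \<ge> 1"
proof -
  obtain q where q: "(state_step mark)\<^sup>*\<^sup>* (p, ws) (q, replicate (loop_count mark p ws) [])"
    using loop_count_reach[OF assms(1-3)] by blast
  from state_steps_nonempty[OF q] assms(4) show ?thesis by (cases "loop_count mark p ws") auto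
qed

text \<open>Circle numbers are compared through their trace sums, which depend only on the values of the
projection and of the mark on the letters present.\<close>

lemma loop_count_eqI:
  assumes "gauss ws" "sign_valued p" "marking_on (set (concat ws)) mark"
    and "gauss ws'" "sign_valued p'" "marking_on (set (concat ws')) mark'"
    and "loop_sum mark p ws = loop_sum mark' p' ws'"
  shows "loop_count mark p ws = loop_count mark' p' ws'"
proof -
  have "(2::real) ^ loop_count mark p ws = 2 ^ loop_count mark' p' ws'"
    using loop_count_sum[OF assms(1-3)] loop_count_sum[OF assms(4-6)] assms(7) by simp
  then show ?thesis by simp
qed

lemma loop_count_step:
  assumes "state_step mark (p, ws) (p', ws')" "gauss ws" "sign_valued p" "marking_on (set (concat ws)) mark"
  shows "loop_count mark p ws = loop_count mark p' ws'"
proof -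
  have "gauss ws' \<and> sign_valued p' \<and> set (concat ws') \<subseteq> set (concat ws) \<and>
      loop_sum mark p' ws' = loop_sum mark p ws"
    using state_step_loop_sum[OF assms(1)] assms(2-) unfolding marking_on_def snd_conv fst_conv by blast
  then show ?thesis using assms(2-) by (intro loop_count_eqI) (auto simp: marking_on_def)
qed

lemma loop_count_circle:
  assumes "gauss ws" "sign_valued p" "marking_on (set (concat ws)) mark"
  shows "loop_count mark p ([] # ws) = Suc (loop_count mark p ws)"
proof -
  have "loop_sum mark p ([] # ws) = 2 * loop_sum mark p ws"
    by (simp add: loop_sum_def sum_distrib_left mult_ac)
  moreover have "gauss ([] # ws)" using assms(1) by (simp add: gauss_def)
  ultimately have "(2::real) ^ loop_count mark p ([] # ws) = 2 ^ Suc (loop_count mark p ws)"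
    using loop_count_sum[OF assms] loop_count_sum[of "[] # ws" p mark] assms by simp
  then show ?thesis by (metis one_less_numeral_iff power_inject_exp semiring_norm(76))
qed

lemma sum_PiE_reindex:
  assumes "bij_betw f X Y"
  shows "(\<Sum>s \<in> Y \<rightarrow>\<^sub>E T. H (restrict (s \<circ> f) X)) = (\<Sum>s \<in> X \<rightarrow>\<^sub>E T. H s)"
  by (rule sum.reindex_bij_witness
      [where i = "\<lambda>s. restrict (s \<circ> inv_into X f) Y" and j = "\<lambda>s. restrict (s \<circ> f) X"])
    (use assms in \<open>auto simp: bij_betw_inv_into_left bij_betw_inv_into_right PiE_iff extensional_def
      bij_betw_apply bij_betwE[OF bij_betw_inv_into] restrict_def fun_eq_iff\<close>)

lemma loop_sum_relabel:
  assumes inj: "inj_on f (set (concat ws))"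
    and p: "\<And>A. A \<in> set (concat ws) \<Longrightarrow> p' (f A) = p A"
    and m: "\<And>A. A \<in> set (concat ws) \<Longrightarrow> mark' (f A) = mark A"
  shows "loop_sum mark' p' (map (map f) ws) = loop_sum mark p ws"
proof -
  let ?X = "set (concat ws)"
  have Y: "set (concat (map (map f) ws)) = f ` ?X" by (auto simp flip: map_concat)
  have w: "word_mat (restrict (g \<circ> f) ?X) w = word_mat g (map f w)" if "w \<in> set ws" for g w
    unfolding word_mat_map by (rule word_mat_cong) (use that in auto)
  have "loop_sum mark p ws = (\<Sum>g \<in> f ` ?X \<rightarrow>\<^sub>E UNIV.
     (\<Prod>A\<in>?X. wick_weight (mark A = p A) (restrict (g \<circ> f) ?X A)) *
     (\<Prod>w\<leftarrow>ws. mtr (word_mat (restrict (g \<circ> f) ?X) w)))"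
    unfolding loop_sum_def by (subst sum_PiE_reindex) (use inj in \<open>auto simp: inj_on_imp_bij_betw\<close>)
  also have "\<dots> = loop_sum mark' p' (map (map f) ws)"
    unfolding loop_sum_def Y prod.reindex[OF inj]
    by (intro sum.cong refl arg_cong2[where f = "(*)"] prod.cong arg_cong[where f = prod_list])
      (use p m w in \<open>auto simp del: set_concat\<close>)
  finally show ?thesis by simp
qed

section \<open>The bracket polynomial and its skein relation\<close>

lemma loop_count_cong:
  assumes "gauss ws" "sign_valued p" "sign_valued p'" "marking_on (set (concat ws)) mark"
    and "\<And>A. A \<in> set (concat ws) \<Longrightarrow> p' A = p A"
    and "\<And>A. A \<in> set (concat ws) \<Longrightarrow> mark' A = mark A"
  shows "loop_count mark' p' ws = loop_count mark p ws"
proof -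
  have "loop_sum mark' p' ws = loop_sum mark p ws"
    using loop_sum_relabel[of "\<lambda>A. A" ws p' p mark' mark] assms(5,6) by simp
  then show ?thesis using assms by (intro loop_count_eqI) (auto simp: marking_on_def)
qed

lemma t_pow_mult: "t_pow m * t_pow n = t_pow (m + n)" "t_pow m * (t_pow n * a) = t_pow (m + n) * a"
  by (simp_all add: t_pow_def mult_single flip: mult.assoc)

lemma t_pow_0 [simp]: "t_pow 0 = 1"
  by (simp add: t_pow_def)

abbreviation circle_value :: laurent where
  "circle_value \<equiv> - t_pow 2 - t_pow (- 2)"

text \<open>The state sum without the writhe factor. Its alphabet is read off from the components, so that
deleting a letter needs no bookkeeping of the alphabet.\<close>

definition bracket :: "('l \<Rightarrow> int) \<Rightarrow> 'l list list \<Rightarrow> laurent" where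
  "bracket p ws = (\<Sum>s \<in> set (concat ws) \<rightarrow>\<^sub>E {- 1, 1}.
     t_pow (\<Sum>A\<in>set (concat ws). s A) * circle_value ^ (loop_count s p ws - 1))"

lemma marking_on_PiE: "s \<in> X \<rightarrow>\<^sub>E {- 1, 1} \<Longrightarrow> marking_on X s"
  unfolding marking_on_def by (auto simp: PiE_iff)

lemma bracket_eqI:
  assumes "set (concat ws) = set (concat ws')"
    and "\<And>s. marking_on (set (concat ws)) s \<Longrightarrow> loop_count s p ws = loop_count s p' ws'"
  shows "bracket p ws = bracket p' ws'"
  unfolding bracket_def assms(1)
proof (rule sum.cong[OF refl])
  fix s assume "s \<in> set (concat ws') \<rightarrow>\<^sub>E {- 1, 1 :: int}"
  then have "marking_on (set (concat ws)) s" unfolding assms(1) by (rule marking_on_PiE)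
  then show "t_pow (sum s (set (concat ws'))) * circle_value ^ (loop_count s p ws - 1) =
      t_pow (sum s (set (concat ws'))) * circle_value ^ (loop_count s p' ws' - 1)"
    using assms(2) by simp
qed

lemma bracket_cong:
  assumes "gauss ws" "sign_valued p" "sign_valued p'" "\<And>A. A \<in> set (concat ws) \<Longrightarrow> p' A = p A"
  shows "bracket p' ws = bracket p ws"
  by (rule bracket_eqI[OF refl]) (rule loop_count_cong, use assms in auto)

lemma bracket_perm:
  assumes "gauss ws" "sign_valued p" "mset ws = mset ws'"
  shows "bracket p ws = bracket p ws'"
  by (rule bracket_eqI)
    (use assms in \<open>auto simp: mset_eq_setD[OF assms(3)] intro!: loop_count_step state_step.permute\<close>)

lemma bracket_shift:
  assumes "gauss ((x @ y) # vs)" "sign_valued p"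
  shows "bracket p ((x @ y) # vs) = bracket p ((y @ x) # vs)"
  by (rule bracket_eqI)
    (use assms state_step.shift[of _ p "[]" x y vs] in \<open>auto intro!: loop_count_step\<close>)

lemma bracket_invert:
  assumes "gauss (w # vs)" "sign_valued p"
  shows "bracket (flip_once w p) (rev w # vs) = bracket p (w # vs)"
  by (rule bracket_eqI[symmetric])
    (use assms state_step.invert[of _ p "[]" w vs] in \<open>auto intro!: loop_count_step\<close>)

lemma bracket_circle:
  assumes "gauss ws" "sign_valued p" "ws \<noteq> []"
  shows "bracket p ([] # ws) = circle_value * bracket p ws"
proof -
  have "circle_value ^ (loop_count s p ([] # ws) - 1) = circle_value * circle_value ^ (loop_count s p ws - 1)"
    if "marking_on (set (concat ws)) s" for s
    using loop_count_circle[OF assms(1,2) that] loop_count_pos[OF assms(1,2) that assms(3)]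
    by (cases "loop_count s p ws") auto
  then show ?thesis unfolding bracket_def sum_distrib_left
    by (intro sum.cong) (auto dest!: marking_on_PiE simp: mult_ac)
qed

text \<open>The states are grouped by the mark of \<open>A\<close>; the circles of a state may be counted by deleting
\<open>A\<close> first.\<close>

lemma bracket_skein:
  assumes d: "gauss ws" and s: "sign_valued p"
    and X: "A \<notin> set (concat ws1)" "set (concat ws) = insert A (set (concat ws1))"
      "set (concat ws2) = set (concat ws1)"
    and 1: "\<And>s. s A = p A \<Longrightarrow> state_step s (p, ws) (p, ws1)"
    and 2: "\<And>s. s A = - p A \<Longrightarrow> state_step s (p, ws) (p2, ws2)"
  shows "bracket p ws = t_pow (p A) * bracket p ws1 + t_pow (- p A) * bracket p2 ws2"
proof -
  let ?X = "set (concat ws1)"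
  have pA: "{- 1, 1} = {p A, - p A}" "p A \<noteq> - p A"
    using s unfolding sign_valued_def by (metis add.inverse_inverse insert_commute, metis add.inverse_inverse one_neq_neg_one)
  have c: "loop_count (s(A := m)) p ws = loop_count s q ws'"
    if st: "state_step (s(A := m)) (p, ws) (q, ws')" and X': "set (concat ws') = ?X"
      and s': "marking_on ?X s" and m: "m = 1 \<or> m = - 1" for s m q ws'
  proof -
    have mk: "marking_on (set (concat ws)) (s(A := m))" using s' m unfolding X(2) marking_on_def by auto
    have "gauss ws'" "sign_valued q" using state_step_loop_sum[OF st] d s mk unfolding marking_on_def by auto
    then have "loop_count (s(A := m)) q ws' = loop_count s q ws'"
      by (intro loop_count_cong) (use X' s' X(1) in auto)
    then show ?thesis using loop_count_step[OF st d s mk] by simp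
  qed
  have e: "(\<Sum>B\<in>?X. if B = A then m else s B) = (\<Sum>B\<in>?X. s B)" for s and m :: int
    by (rule sum.cong) (use X(1) in auto)
  have m1: "p A = 1 \<or> p A = - 1" "- p A = 1 \<or> - p A = - 1" using s unfolding sign_valued_def by (metis add.inverse_inverse)+
  have "bracket p ws = (\<Sum>s \<in> ?X \<rightarrow>\<^sub>E {- 1, 1}. \<Sum>m\<in>{- 1, 1}.
      t_pow (m + (\<Sum>B\<in>?X. s B)) * circle_value ^ (loop_count (s(A := m)) p ws - 1))"
    unfolding bracket_def X(2) sum_PiE_insert[OF X(1)]
    using X(1) by (intro sum.cong refl) (simp add: e del: set_concat)
  also have "\<dots> = (\<Sum>s \<in> ?X \<rightarrow>\<^sub>E {- 1, 1}.
      t_pow (p A) * (t_pow (\<Sum>B\<in>?X. s B) * circle_value ^ (loop_count s p ws1 - 1)) +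
      t_pow (- p A) * (t_pow (\<Sum>B\<in>?X. s B) * circle_value ^ (loop_count s p2 ws2 - 1)))"
  proof (rule sum.cong[OF refl])
    fix s assume "s \<in> ?X \<rightarrow>\<^sub>E {- 1, 1 :: int}"
    then have s': "marking_on ?X s" by (rule marking_on_PiE)
    have "loop_count (s(A := p A)) p ws = loop_count s p ws1"
      "loop_count (s(A := - p A)) p ws = loop_count s p2 ws2"
      by (rule c; use 1 2 X s' m1 in simp)+
    then show "(\<Sum>m\<in>{- 1, 1}. t_pow (m + (\<Sum>B\<in>?X. s B)) * circle_value ^ (loop_count (s(A := m)) p ws - 1)) =
      t_pow (p A) * (t_pow (\<Sum>B\<in>?X. s B) * circle_value ^ (loop_count s p ws1 - 1)) +
      t_pow (- p A) * (t_pow (\<Sum>B\<in>?X. s B) * circle_value ^ (loop_count s p2 ws2 - 1))"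
      unfolding pA(1) using pA(2) by (simp add: t_pow_mult del: set_concat)
  qed
  also have "\<dots> = t_pow (p A) * bracket p ws1 + t_pow (- p A) * bracket p2 ws2"
    unfolding bracket_def X(3) sum.distrib sum_distrib_left ..
  finally show ?thesis .
qed

lemma bracket_skein_same:
  assumes d: "gauss ((A # x @ A # y) # vs)" and s: "sign_valued p"
  shows "bracket p ((A # x @ A # y) # vs) =
    t_pow (p A) * bracket p (x # y # vs) + t_pow (- p A) * bracket (flip_once x p) ((rev x @ y) # vs)"
  by (rule bracket_skein[OF d s])
    (use gauss_fresh_same[of "[]" A x y vs] d state_step.delete_same_eq[of _ A p "[]" x y vs]
      state_step.delete_same_neg[of _ A p "[]" x y vs] in auto)

lemma bracket_skein_diff:
  assumes d: "gauss ((A # x) # (A # y) # vs)" and s: "sign_valued p"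
  shows "bracket p ((A # x) # (A # y) # vs) =
    t_pow (p A) * bracket p ((x @ y) # vs) + t_pow (- p A) * bracket (flip_once x p) ((rev x @ y) # vs)"
  by (rule bracket_skein[OF d s])
    (use gauss_fresh_diff[of "[]" A x y vs] d state_step.delete_diff_eq[of _ A p "[]" x y vs]
      state_step.delete_diff_neg[of _ A p "[]" x y vs] in auto)

lemma flip_once_Nil [simp]: "flip_once [] p = p"
  by (simp add: flip_once_def)

text \<open>One smoothing splits off a circle, the other does not, and
\<open>t\<^sup>s (- t\<^sup>2 - t\<^sup>-\<^sup>2) + t\<^sup>-\<^sup>s = - t\<^sup>3\<^sup>s\<close> for \<open>s = 1\<close> and \<open>s = - 1\<close>.\<close>

lemma bracket_curl:
  assumes d: "gauss ((A # A # y) # vs)" and s: "sign_valued p"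
  shows "bracket p ((A # A # y) # vs) = - t_pow (3 * p A) * bracket p (y # vs)"
proof -
  have "gauss (y # vs)" using gauss_same(2)[of "[]" A "[]" y vs] d by simp
  then have "bracket p ((A # A # y) # vs) =
      t_pow (p A) * (circle_value * bracket p (y # vs)) + t_pow (- p A) * bracket p (y # vs)"
    using bracket_skein_same[of A "[]" y vs p] d s bracket_circle[of "y # vs" p] by simp
  moreover have "p A = 1 \<or> p A = - 1" using s by (simp add: sign_valued_def)
  ultimately show ?thesis by (auto simp: left_diff_distrib right_diff_distrib t_pow_mult)
qed

section \<open>Cancelling two letters of opposite signs\<close>

lemma gauss_remove:
  assumes "gauss ws" "\<And>C. C \<notin> S \<Longrightarrow> count_list (concat ws') C = count_list (concat ws) C"
    "set (concat ws') \<inter> S = {}"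
  shows "gauss ws'"
  using assms unfolding gauss_def by (metis count_list_0_iff disjoint_iff)

lemma gauss_fresh_pair:
  assumes "gauss ws" "count_list (concat ws) = count_list (A # B # u @ A # B # v)"
  shows "A \<noteq> B" "A \<notin> set u" "A \<notin> set v" "B \<notin> set u" "B \<notin> set v"
  using spec[OF assms(1)[unfolded gauss_def], of A] spec[OF assms(1)[unfolded gauss_def], of B]
  by (auto simp: assms(2) simp flip: count_list_0_iff split: if_splits)

lemma gauss_cong: "gauss ws \<Longrightarrow> count_list (concat ws') = count_list (concat ws) \<Longrightarrow> gauss ws'"
  by (simp add: gauss_def)

lemma flip_once_Cons_same: "A \<notin> set w \<Longrightarrow> flip_once (A # w) p A = - p A"
  by (simp add: flip_once_def)

lemma flip_once_Cons_diff: "A \<noteq> B \<Longrightarrow> flip_once (B # w) p A = flip_once w p A"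
  by (simp add: flip_once_def)

lemma flip_once_rev [simp]: "flip_once (rev w) = flip_once w"
  by (simp add: flip_once_def count_list_rev fun_eq_iff)

lemma flip_once_twice [simp]: "flip_once w (flip_once w p) = p"
  by (simp add: flip_once_def fun_eq_iff)

lemma sign_valuedD: "sign_valued p \<Longrightarrow> p A = 1 \<or> p A = - 1"
  by (simp add: sign_valued_def)

text \<open>Smoothing \<open>A\<close> one way leaves the letter \<open>B\<close>, which is smoothed again; smoothing it the other way
makes the two occurrences of \<open>B\<close> adjacent, a curl. The terms with the wrong connection cancel.\<close>

lemma bracket_R2_parallel_same:
  assumes d: "gauss ((A # B # x @ A # B # y) # vs)" and s: "sign_valued p" and AB: "p B = - p A"
  shows "bracket p ((A # B # x @ A # B # y) # vs) = bracket p ((x @ y) # vs)"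
proof -
  have f: "A \<noteq> B" "A \<notin> set x" "A \<notin> set (y @ concat vs)" "B \<notin> set x" "B \<notin> set (y @ concat vs)"
    by (rule gauss_fresh_pair[OF d, of A B x "y @ concat vs"]; simp add: fun_eq_iff)+
  define p1 where "p1 = flip_once (B # x) p"
  have s1: "sign_valued p1" using s by (simp add: p1_def)
  have p1B: "p1 B = p A" using f AB by (simp add: p1_def flip_once_Cons_same)
  have d1: "gauss ((B # x) # (B # y) # vs)" "gauss ((B # B # y @ rev x) # vs)" "gauss ((rev x @ B # B # y) # vs)"
    by (rule gauss_remove[OF d, of "{A}"]; use f in \<open>simp add: count_list_rev\<close>)+
  have d2: "gauss ((y @ rev x) # vs)" "gauss ((rev x @ y) # vs)"
    by (rule gauss_remove[OF d, of "{A, B}"]; use f in \<open>auto simp: count_list_rev\<close>)+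
  have "bracket p1 ((rev x @ B # B # y) # vs) = bracket p1 ((B # B # y @ rev x) # vs)"
    using bracket_shift[of "rev x" "B # B # y" vs p1] d1 s1 by simp
  also have "\<dots> = - t_pow (3 * p A) * bracket p1 ((y @ rev x) # vs)"
    using bracket_curl[OF d1(2) s1] p1B by simp
  also have "bracket p1 ((y @ rev x) # vs) = bracket p1 ((rev x @ y) # vs)"
    using bracket_shift[of "rev x" y vs p1] d2 s1 by simp
  also have "\<dots> = bracket (flip_once x p) ((rev x @ y) # vs)"
    by (rule bracket_cong[OF d2(2)]) (use s s1 f in \<open>auto simp: p1_def intro!: flip_once_Cons_diff\<close>)
  finally have 1: "bracket p1 ((rev x @ B # B # y) # vs) =
      - t_pow (3 * p A) * bracket (flip_once x p) ((rev x @ y) # vs)" .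
  have 2: "bracket p ((B # x) # (B # y) # vs) =
      t_pow (- p A) * bracket p ((x @ y) # vs) + t_pow (p A) * bracket (flip_once x p) ((rev x @ y) # vs)"
    using bracket_skein_diff[OF d1(1) s] AB by simp
  have "bracket p ((A # B # x @ A # B # y) # vs) =
      t_pow (p A) * bracket p ((B # x) # (B # y) # vs) + t_pow (- p A) * bracket p1 ((rev x @ B # B # y) # vs)"
    using bracket_skein_same[of A "B # x" "B # y" vs p] d s by (simp add: p1_def)
  then show ?thesis using sign_valuedD[OF s, of A] unfolding 1 2
    by (auto simp: distrib_left t_pow_mult)
qed

text \<open>Now the first smoothing of \<open>A\<close> produces the curl, and the bracket of the split component
\<open>x | y\<close> cancels.\<close>

lemma bracket_R2_antiparallel_same:
  assumes d: "gauss ((A # B # x @ B # A # y) # vs)" and s: "sign_valued p" and AB: "p B = - p A"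
  shows "bracket p ((A # B # x @ B # A # y) # vs) = bracket p ((x @ y) # vs)"
proof -
  have f: "A \<noteq> B" "A \<notin> set x" "A \<notin> set (y @ concat vs)" "B \<notin> set x" "B \<notin> set (y @ concat vs)"
    by (rule gauss_fresh_pair[OF d, of A B x "y @ concat vs"]; simp add: fun_eq_iff)+
  define p1 where "p1 = flip_once (B # x @ [B]) p"
  have s1: "sign_valued p1" using s by (simp add: p1_def)
  have p1: "p1 C = flip_once x p C" if "C \<noteq> B" for C using that by (simp add: p1_def flip_once_def)
  have p1B: "p1 B = - p A" using f AB by (simp add: p1_def flip_once_def)
  have d1: "gauss ((B # x @ [B]) # y # vs)" "gauss ((B # B # x) # y # vs)" "gauss ((B # rev x @ B # y) # vs)"
    by (rule gauss_remove[OF d, of "{A}"]; use f in \<open>simp add: count_list_rev\<close>)+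
  have d2: "gauss (x # y # vs)" "gauss (rev x # y # vs)" "gauss ((x @ y) # vs)"
    by (rule gauss_remove[OF d, of "{A, B}"]; use f in \<open>auto simp: count_list_rev\<close>)+
  have 1: "bracket p ((B # x @ [B]) # y # vs) = - t_pow (- 3 * p A) * bracket p (x # y # vs)"
    using bracket_shift[of "B # x" "[B]" "y # vs" p] bracket_curl[OF d1(2) s] d1(1) s AB by simp
  have "bracket p1 (rev x # y # vs) = bracket (flip_once x p) (rev x # y # vs)"
    by (rule bracket_cong[OF d2(2)]) (use s s1 f in \<open>auto intro!: p1\<close>)
  also have "\<dots> = bracket p (x # y # vs)" by (rule bracket_invert[OF d2(1) s])
  finally have 2: "bracket p1 (rev x # y # vs) = bracket p (x # y # vs)" .
  have 3: "bracket (flip_once x p1) ((x @ y) # vs) = bracket p ((x @ y) # vs)"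
  proof (rule bracket_cong[OF d2(3)])
    fix C assume "C \<in> set (concat ((x @ y) # vs))"
    then have "C \<noteq> B" using f by auto
    then have "flip_once x p1 C = flip_once x (flip_once x p) C"
      using p1[of C] unfolding flip_once_def[of x p1] flip_once_def[of x "flip_once x p"] by simp
    then show "flip_once x p1 C = p C" by simp
  qed (use s s1 in auto)
  have "bracket p1 ((B # rev x @ B # y) # vs) =
      t_pow (- p A) * bracket p (x # y # vs) + t_pow (p A) * bracket p ((x @ y) # vs)"
    using bracket_skein_same[OF d1(3) s1] p1B 2 3 by simp
  then have "bracket p ((A # B # x @ B # A # y) # vs) =
      t_pow (p A) * (- t_pow (- 3 * p A) * bracket p (x # y # vs)) +
      t_pow (- p A) * (t_pow (- p A) * bracket p (x # y # vs) + t_pow (p A) * bracket p ((x @ y) # vs))"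
    using bracket_skein_same[of A "B # x @ [B]" y vs p] d s 1 by (simp add: p1_def)
  then show ?thesis using sign_valuedD[OF s, of A] by (auto simp: distrib_left t_pow_mult)
qed

lemma bracket_R2_parallel_diff:
  assumes d: "gauss ((A # B # x) # (A # B # y) # vs)" and s: "sign_valued p" and AB: "p B = - p A"
  shows "bracket p ((A # B # x) # (A # B # y) # vs) = bracket p (x # y # vs)"
proof -
  have f: "A \<noteq> B" "A \<notin> set x" "A \<notin> set (y @ concat vs)" "B \<notin> set x" "B \<notin> set (y @ concat vs)"
    by (rule gauss_fresh_pair[OF d, of A B x "y @ concat vs"]; simp add: fun_eq_iff)+
  define p1 where "p1 = flip_once (B # x) p"
  have s1: "sign_valued p1" using s by (simp add: p1_def)
  have p1B: "p1 B = p A" using f AB by (simp add: p1_def flip_once_Cons_same)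
  have d1: "gauss ((B # x @ B # y) # vs)" "gauss ((B # B # y @ rev x) # vs)" "gauss ((rev x @ B # B # y) # vs)"
    by (rule gauss_remove[OF d, of "{A}"]; use f in \<open>simp add: count_list_rev\<close>)+
  have d2: "gauss ((y @ rev x) # vs)" "gauss ((rev x @ y) # vs)"
    by (rule gauss_remove[OF d, of "{A, B}"]; use f in \<open>auto simp: count_list_rev\<close>)+
  have "bracket p1 ((rev x @ B # B # y) # vs) = bracket p1 ((B # B # y @ rev x) # vs)"
    using bracket_shift[of "rev x" "B # B # y" vs p1] d1 s1 by simp
  also have "\<dots> = - t_pow (3 * p A) * bracket p1 ((y @ rev x) # vs)"
    using bracket_curl[OF d1(2) s1] p1B by simp
  also have "bracket p1 ((y @ rev x) # vs) = bracket p1 ((rev x @ y) # vs)"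
    using bracket_shift[of "rev x" y vs p1] d2 s1 by simp
  also have "\<dots> = bracket (flip_once x p) ((rev x @ y) # vs)"
    by (rule bracket_cong[OF d2(2)]) (use s s1 f in \<open>auto simp: p1_def intro!: flip_once_Cons_diff\<close>)
  finally have 1: "bracket p1 ((rev x @ B # B # y) # vs) =
      - t_pow (3 * p A) * bracket (flip_once x p) ((rev x @ y) # vs)" .
  have 2: "bracket p ((B # x @ B # y) # vs) =
      t_pow (- p A) * bracket p (x # y # vs) + t_pow (p A) * bracket (flip_once x p) ((rev x @ y) # vs)"
    using bracket_skein_same[OF d1(1) s] AB by simp
  have "bracket p ((A # B # x) # (A # B # y) # vs) =
      t_pow (p A) * bracket p ((B # x @ B # y) # vs) + t_pow (- p A) * bracket p1 ((rev x @ B # B # y) # vs)"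
    using bracket_skein_diff[of A "B # x" "B # y" vs p] d s by (simp add: p1_def)
  then show ?thesis using sign_valuedD[OF s, of A] unfolding 1 2
    by (auto simp: distrib_left t_pow_mult)
qed

lemma bracket_swap:
  assumes "gauss (u # v # vs)" "sign_valued p"
  shows "bracket p (u # v # vs) = bracket p (v # u # vs)"
  by (rule bracket_perm[OF assms]) simp

text \<open>Inverting the second component makes the two strands parallel; both signs change, so they remain
opposite.\<close>

lemma bracket_R2_antiparallel_diff:
  assumes d: "gauss ((A # B # x) # (B # A # y) # vs)" and s: "sign_valued p" and AB: "p B = - p A"
  shows "bracket p ((A # B # x) # (B # A # y) # vs) = bracket p (x # y # vs)"
proof -
  have f: "A \<noteq> B" "A \<notin> set x" "A \<notin> set (y @ concat vs)" "B \<notin> set x" "B \<notin> set (y @ concat vs)"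
    by (rule gauss_fresh_pair[OF d, of A B x "y @ concat vs"]; simp add: fun_eq_iff)+
  define p1 where "p1 = flip_once (B # A # y) p"
  have s1: "sign_valued p1" using s by (simp add: p1_def)
  have p1: "p1 C = flip_once y p C" if "C \<noteq> A" "C \<noteq> B" for C using that by (simp add: p1_def flip_once_def)
  have p1AB: "p1 A = - p A" "p1 B = p A" using f AB by (simp_all add: p1_def flip_once_def)
  have d1: "gauss ((B # A # y) # (A # B # x) # vs)" "gauss ((rev y @ [A, B]) # (A # B # x) # vs)"
    "gauss ((A # B # rev y) # (A # B # x) # vs)"
    by (rule gauss_cong[OF d], simp add: fun_eq_iff count_list_rev)+
  have d2: "gauss (rev y # x # vs)" "gauss (y # x # vs)"
    by (rule gauss_remove[OF d, of "{A, B}"]; use f in \<open>auto simp: count_list_rev\<close>)+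
  have "bracket p ((A # B # x) # (B # A # y) # vs) = bracket p ((B # A # y) # (A # B # x) # vs)"
    by (rule bracket_swap[OF d s])
  also have "\<dots> = bracket p1 ((rev y @ [A, B]) # (A # B # x) # vs)"
    using bracket_invert[OF d1(1) s] by (simp add: p1_def)
  also have "\<dots> = bracket p1 ((A # B # rev y) # (A # B # x) # vs)"
    using bracket_shift[OF d1(2) s1] by simp
  also have "\<dots> = bracket p1 (rev y # x # vs)"
    by (rule bracket_R2_parallel_diff[OF d1(3) s1]) (simp add: p1AB)
  also have "\<dots> = bracket (flip_once y p) (rev y # x # vs)"
    by (rule bracket_cong[OF d2(1)]) (use s s1 f in \<open>auto intro!: p1\<close>)
  also have "\<dots> = bracket p (y # x # vs)" by (rule bracket_invert[OF d2(2) s])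
  also have "\<dots> = bracket p (x # y # vs)" by (rule bracket_swap[OF d2(2) s])
  finally show ?thesis .
qed

text \<open>Used for isomorphisms of alphabets and, with a transposition of two letters, for the third move.\<close>

lemma bracket_relabel:
  assumes d: "gauss ws" "gauss (map (map f) ws)" and s: "sign_valued p" "sign_valued p'"
    and inj: "inj_on f (set (concat ws))" and p: "\<And>A. A \<in> set (concat ws) \<Longrightarrow> p' (f A) = p A"
  shows "bracket p' (map (map f) ws) = bracket p ws"
proof -
  let ?X = "set (concat ws)"
  have Y: "set (concat (map (map f) ws)) = f ` ?X" by (auto simp flip: map_concat)
  have "bracket p ws = (\<Sum>s \<in> f ` ?X \<rightarrow>\<^sub>E {- 1, 1}. t_pow (\<Sum>A\<in>?X. restrict (s \<circ> f) ?X A) *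
      circle_value ^ (loop_count (restrict (s \<circ> f) ?X) p ws - 1))"
    unfolding bracket_def by (rule sum_PiE_reindex[symmetric]) (use inj in \<open>auto simp: inj_on_imp_bij_betw\<close>)
  also have "\<dots> = bracket p' (map (map f) ws)"
    unfolding bracket_def Y sum.reindex[OF inj]
  proof (rule sum.cong[OF refl])
    fix s assume "s \<in> f ` ?X \<rightarrow>\<^sub>E {- 1, 1 :: int}"
    then have m: "marking_on (f ` ?X) s" by (rule marking_on_PiE)
    have "loop_count (restrict (s \<circ> f) ?X) p ws = loop_count s p' (map (map f) ws)"
    proof (rule loop_count_eqI)
      show "loop_sum (restrict (s \<circ> f) ?X) p ws = loop_sum s p' (map (map f) ws)"
        by (rule loop_sum_relabel[symmetric]) (use inj p in auto)
    qed (use d s m in \<open>auto simp: marking_on_def simp flip: Y\<close>)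
    then show "t_pow (\<Sum>A\<in>?X. restrict (s \<circ> f) ?X A) *
        circle_value ^ (loop_count (restrict (s \<circ> f) ?X) p ws - 1) =
      t_pow (sum (s \<circ> f) ?X) * circle_value ^ (loop_count s p' (map (map f) ws) - 1)"
      using sum.cong[of ?X ?X "restrict (s \<circ> f) ?X" "s \<circ> f"] by simp
  qed
  finally show ?thesis by simp
qed

section \<open>Invariance under the third move\<close>

text \<open>Rotated to the front, the strands of a move are all that the skein relation sees of a phrase.\<close>

lemma bracket_front:
  assumes "gauss (us @ (u @ w) # vs)" "sign_valued p"
  shows "bracket p (us @ (u @ w) # vs) = bracket p ((w @ u) # us @ vs)"
proof -
  have "bracket p (us @ (u @ w) # vs) = bracket p ((u @ w) # us @ vs)"
    by (rule bracket_perm[OF assms]) simp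
  also have "\<dots> = bracket p ((w @ u) # us @ vs)"
    by (rule bracket_shift[OF gauss_cong[OF assms(1)] assms(2)]) (simp add: fun_eq_iff)
  finally show ?thesis .
qed

lemma bracket_front_pair:
  assumes "gauss (us @ (u @ v) # ms @ (x @ w) # vs)" "sign_valued p"
  shows "bracket p (us @ (u @ v) # ms @ (x @ w) # vs) = bracket p ((v @ u) # (w @ x) # us @ ms @ vs)"
proof -
  have "bracket p (us @ (u @ v) # ms @ (x @ w) # vs) = bracket p ((w @ x) # (us @ (u @ v) # ms) @ vs)"
    using bracket_front[of "us @ (u @ v) # ms" x w vs p] assms by simp
  also have "\<dots> = bracket p (((w @ x) # us) @ (u @ v) # ms @ vs)" by simp
  also have "\<dots> = bracket p ((v @ u) # ((w @ x) # us) @ ms @ vs)"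
    by (rule bracket_front[OF gauss_cong[OF assms(1)] assms(2)]) (simp add: fun_eq_iff)
  finally show ?thesis by simp
qed

text \<open>The position of the strand through \<open>B\<close> and \<open>C\<close> in the third move: \<open>y\<close> is what
follows \<open>AC\<close> on its component, and \<open>vs\<close> are the components without \<open>A\<close>.\<close>

definition adjacent_in :: "'l \<Rightarrow> 'l \<Rightarrow> 'l list \<Rightarrow> 'l list list \<Rightarrow> bool" where
  "adjacent_in B C y vs \<longleftrightarrow> (\<exists>y1 y2. y = y1 @ B # C # y2) \<or>
     (\<exists>vs1 q1 q2 vs2. vs = vs1 @ (q1 @ B # C # q2) # vs2)"

lemma map_transpose_idle [simp]:
  "B \<notin> set w \<Longrightarrow> C \<notin> set w \<Longrightarrow> map (transpose B C) w = w"
  by (rule map_idI) (metis transpose_apply_other)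

lemma map_map_transpose_idle [simp]:
  "B \<notin> set (concat ws) \<Longrightarrow> C \<notin> set (concat ws) \<Longrightarrow> map (map (transpose B C)) ws = ws"
  by (rule map_idI) (auto intro!: map_transpose_idle)

lemma fresh_BC:
  assumes "gauss ws" "count_list (concat ws) = count_list (B # C # B # C # u)"
  shows "B \<noteq> C" "B \<notin> set u" "C \<notin> set u"
  using spec[OF assms(1)[unfolded gauss_def], of B] spec[OF assms(1)[unfolded gauss_def], of C]
  by (auto simp: assms(2) simp flip: count_list_0_iff split: if_splits)

text \<open>Smoothing \<open>A\<close> against the orientation leaves two strands that cross at \<open>B\<close> and \<open>C\<close> with
opposite signs. The first phrase arises from the left side of the third move, the second and the
third from its right side when the two occurrences of \<open>A\<close> share a component and when they do not;
cancelling \<open>B\<close> and \<open>C\<close> leaves the same phrase \<open>red\<close> in each case. It must not depend on \<open>p\<close>,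
since the two sides of the move reach it with different projections of \<open>B\<close> and \<open>C\<close>.\<close>

lemma triangle_reduction:
  fixes n y :: "'l list" and vs :: "'l list list" and B C :: 'l
  defines "f \<equiv> transpose B C"
  assumes d: "gauss ((n @ B # C # y) # vs)" and adj: "adjacent_in B C y vs"
  shows "\<exists>red. gauss red \<and> B \<notin> set (concat red) \<and> C \<notin> set (concat red) \<and>
    (\<forall>p. sign_valued p \<longrightarrow> p C = - p B \<longrightarrow>
      bracket p ((n @ B # C # y) # vs) = bracket p red \<and>
      bracket p ((C # n @ map f y @ [B]) # map (map f) vs) = bracket p red \<and>
      bracket p ((B # n @ map f y @ [C]) # map (map f) vs) = bracket p red)"
  using adj unfolding adjacent_in_def
proof (elim disjE exE)
  fix y1 y2 assume y: "y = y1 @ B # C # y2"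
  have fr: "B \<noteq> C" "B \<notin> set (n @ y1 @ y2 @ concat vs)" "C \<notin> set (n @ y1 @ y2 @ concat vs)"
    by (rule fresh_BC[OF d, of B C "n @ y1 @ y2 @ concat vs"]; simp add: y fun_eq_iff)+
  have fy: "map f y = y1 @ C # B # y2" and fvs: "map (map f) vs = vs"
    using fr by (simp_all add: y f_def)
  have d': "gauss ((n @ B # C # y1 @ B # C # y2) # vs)" "gauss ((B # C # y1 @ B # C # y2 @ n) # vs)"
    "gauss ((B # C # (n @ y1) @ C # B # y2) # vs)" "gauss ((C # B # (n @ y1) @ C # B # y2) # vs)"
    "gauss ((C # n @ y1 @ C # B # y2 @ [B]) # vs)" "gauss ((B # n @ y1 @ C # B # y2 @ [C]) # vs)"
    by (rule gauss_cong[OF d], simp add: y fun_eq_iff)+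
  have dr: "gauss ((n @ y1 @ y2) # vs)" "gauss ((y1 @ y2 @ n) # vs)"
    by (rule gauss_remove[OF d, of "{B, C}"]; use fr in \<open>auto simp: y\<close>)+
  show ?thesis
  proof (rule exI[of _ "(n @ y1 @ y2) # vs"], intro conjI allI impI)
    fix p assume p: "sign_valued p" "p C = - p B"
    then have p': "p B = - p C" by simp
    have "bracket p ((n @ B # C # y1 @ B # C # y2) # vs) = bracket p ((B # C # y1 @ B # C # y2 @ n) # vs)"
      using bracket_shift[of n "B # C # y1 @ B # C # y2" vs p] d'(1) p by simp
    also have "\<dots> = bracket p ((y1 @ y2 @ n) # vs)"
      using bracket_R2_parallel_same[OF d'(2) p] by simp
    also have "\<dots> = bracket p ((n @ y1 @ y2) # vs)"
      using bracket_shift[of "y1 @ y2" n vs p] dr p by simp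
    finally show "bracket p ((n @ B # C # y) # vs) = bracket p ((n @ y1 @ y2) # vs)" by (simp add: y)
    have "bracket p ((C # n @ y1 @ C # B # y2 @ [B]) # vs) = bracket p ((B # C # (n @ y1) @ C # B # y2) # vs)"
      using bracket_shift[of "C # n @ y1 @ C # B # y2" "[B]" vs p] d'(5) p by simp
    also have "\<dots> = bracket p ((n @ y1 @ y2) # vs)"
      using bracket_R2_antiparallel_same[OF d'(3) p] by simp
    finally show "bracket p ((C # n @ map f y @ [B]) # map (map f) vs) = bracket p ((n @ y1 @ y2) # vs)"
      by (simp add: fy fvs)
    have "bracket p ((B # n @ y1 @ C # B # y2 @ [C]) # vs) = bracket p ((C # B # (n @ y1) @ C # B # y2) # vs)"
      using bracket_shift[of "B # n @ y1 @ C # B # y2" "[C]" vs p] d'(6) p by simp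
    also have "\<dots> = bracket p ((n @ y1 @ y2) # vs)"
      using bracket_R2_parallel_same[OF d'(4) p(1) p'] by simp
    finally show "bracket p ((B # n @ map f y @ [C]) # map (map f) vs) = bracket p ((n @ y1 @ y2) # vs)"
      by (simp add: fy fvs)
  qed (use dr fr in \<open>auto simp: y\<close>)
next
  fix vs1 q1 q2 vs2 assume vs: "vs = vs1 @ (q1 @ B # C # q2) # vs2"
  have fr: "B \<noteq> C" "B \<notin> set (n @ y @ q1 @ q2 @ concat vs1 @ concat vs2)"
    "C \<notin> set (n @ y @ q1 @ q2 @ concat vs1 @ concat vs2)"
    by (rule fresh_BC[OF d, of B C "n @ y @ q1 @ q2 @ concat vs1 @ concat vs2"]; simp add: vs fun_eq_iff)+
  have fy: "map f y = y" and fvs: "map (map f) vs = vs1 @ (q1 @ C # B # q2) # vs2"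
    using fr by (simp_all add: vs f_def)
  have d': "gauss ((n @ B # C # y) # vs1 @ (q1 @ B # C # q2) # vs2)"
    "gauss ((B # C # y @ n) # (B # C # q2 @ q1) # vs1 @ vs2)"
    "gauss ((B # C # n @ y) # (C # B # q2 @ q1) # vs1 @ vs2)"
    "gauss ((C # B # n @ y) # (C # B # q2 @ q1) # vs1 @ vs2)"
    "gauss (((C # n @ y) @ [B]) # vs1 @ (q1 @ C # B # q2) # vs2)"
    "gauss (((B # n @ y) @ [C]) # vs1 @ (q1 @ C # B # q2) # vs2)"
    by (rule gauss_cong[OF d], simp add: vs fun_eq_iff)+
  let ?red = "(n @ y) # (q2 @ q1) # vs1 @ vs2"
  have dr: "gauss ?red" "gauss ((y @ n) # (q2 @ q1) # vs1 @ vs2)"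
    by (rule gauss_remove[OF d, of "{B, C}"]; use fr in \<open>auto simp: vs\<close>)+
  show ?thesis
  proof (rule exI[of _ ?red], intro conjI allI impI)
    fix p assume p: "sign_valued p" "p C = - p B"
    then have p': "p B = - p C" by simp
    have "bracket p ((n @ B # C # y) # vs1 @ (q1 @ B # C # q2) # vs2) =
        bracket p ((B # C # y @ n) # (B # C # q2 @ q1) # vs1 @ vs2)"
      using bracket_front_pair[of "[]" n "B # C # y" vs1 q1 "B # C # q2" vs2 p] d'(1) p by simp
    also have "\<dots> = bracket p ((y @ n) # (q2 @ q1) # vs1 @ vs2)"
      using bracket_R2_parallel_diff[OF d'(2) p] by simp
    also have "\<dots> = bracket p ?red" by (rule bracket_shift[OF dr(2) p(1)])
    finally show "bracket p ((n @ B # C # y) # vs) = bracket p ?red" by (simp add: vs)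
    have "bracket p (((C # n @ y) @ [B]) # vs1 @ (q1 @ C # B # q2) # vs2) =
        bracket p ((B # C # n @ y) # (C # B # q2 @ q1) # vs1 @ vs2)"
      using bracket_front_pair[of "[]" "C # n @ y" "[B]" vs1 q1 "C # B # q2" vs2 p] d'(5) p by simp
    also have "\<dots> = bracket p ?red" by (rule bracket_R2_antiparallel_diff[OF d'(3) p])
    finally show "bracket p ((C # n @ map f y @ [B]) # map (map f) vs) = bracket p ?red"
      by (simp add: fy fvs)
    have "bracket p (((B # n @ y) @ [C]) # vs1 @ (q1 @ C # B # q2) # vs2) =
        bracket p ((C # B # n @ y) # (C # B # q2 @ q1) # vs1 @ vs2)"
      using bracket_front_pair[of "[]" "B # n @ y" "[C]" vs1 q1 "C # B # q2" vs2 p] d'(6) p by simp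
    also have "\<dots> = bracket p ?red" by (rule bracket_R2_parallel_diff[OF d'(4) p(1) p'])
    finally show "bracket p ((B # n @ map f y @ [C]) # map (map f) vs) = bracket p ?red"
      by (simp add: fy fvs)
  qed (use dr fr in \<open>auto simp: vs\<close>)
qed

lemma adjacent_counts:
  assumes "adjacent_in B C y vs"
  shows "\<exists>u. count_list (concat ((m @ y) # vs)) = count_list (B # C # m @ u)"
  using assms unfolding adjacent_in_def
proof (elim disjE exE)
  fix y1 y2 assume "y = y1 @ B # C # y2"
  then show ?thesis by (intro exI[of _ "y1 @ y2 @ concat vs"]) (simp add: fun_eq_iff)
next
  fix vs1 q1 q2 vs2 assume "vs = vs1 @ (q1 @ B # C # q2) # vs2"
  then show ?thesis
    by (intro exI[of _ "y @ concat vs1 @ q1 @ q2 @ concat vs2"]) (simp add: fun_eq_iff)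
qed

lemma triangle_fresh:
  assumes d: "gauss ws" and adj: "adjacent_in B C y vs"
    and c: "\<And>X. count_list (concat ws) X = count_list (A # B # A # C # m @ y @ concat vs) X"
  shows "A \<noteq> B" "A \<noteq> C" "B \<noteq> C" "A \<notin> set m" "A \<notin> set y" "A \<notin> set (concat vs)"
    "B \<notin> set m" "C \<notin> set m"
proof -
  obtain u where u0: "count_list (concat ((m @ y) # vs)) = count_list (B # C # m @ u)"
    using adjacent_counts[OF adj] by blast
  have u: "count_list m X + count_list y X + count_list (concat vs) X =
      (if B = X then 1 else 0) + (if C = X then 1 else 0) + count_list m X + count_list u X" for X
    using fun_cong[OF u0, of X] by (cases "B = X"; cases "C = X") simp_all
  have N: "count_list (concat ws) X = (if A = X then 2 else 0) + (if B = X then 2 else 0) +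
      (if C = X then 2 else 0) + count_list m X + count_list u X" for X
    using u[of X] by (simp add: c)
  have N2: "count_list (concat ws) X \<le> 2" for X using d unfolding gauss_def by (metis le_refl zero_le)
  show ne: "A \<noteq> B" "A \<noteq> C" "B \<noteq> C"
    using N[of A] N2[of A] N[of B] N2[of B] by (auto split: if_splits)
  have "count_list m X + count_list u X = 0" if "X = A \<or> X = B \<or> X = C" for X
    using N[of X] N2[of X] that by (elim disjE) simp_all
  then have z: "count_list m X = 0" "count_list u X = 0" if "X = A \<or> X = B \<or> X = C" for X
    using that by simp_all
  have "count_list y A = 0" "count_list (concat vs) A = 0" using u[of A] z[of A] ne by simp_all
  then show "A \<notin> set m" "A \<notin> set y" "A \<notin> set (concat vs)" "B \<notin> set m" "C \<notin> set m"
    using z unfolding count_list_0_iff by blast+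
qed

lemma gauss_map_inj: "inj f \<Longrightarrow> surj f \<Longrightarrow> gauss ws \<Longrightarrow> gauss (map (map f) ws)"
  unfolding gauss_def by (metis count_list_map_conv map_concat surjD)

lemma gauss_transpose: "gauss ws \<Longrightarrow> gauss (map (map (transpose B C)) ws)"
  by (rule gauss_map_inj) (simp_all add: inj_transpose)

lemma bracket_transpose:
  assumes "gauss ws" "sign_valued p" "p B = p C"
  shows "bracket p (map (map (transpose B C)) ws) = bracket p ws"
  by (rule bracket_relabel) (use assms in \<open>auto simp: gauss_transpose transpose_def\<close>)

text \<open>The third move in the form where both occurrences of \<open>A\<close> lie on one component, rotated so that
it begins with \<open>A\<close>. The right side is written with the transposition of \<open>B\<close> and \<open>C\<close>, whose
only effect is to turn the remaining \<open>BC\<close> into \<open>CB\<close>.\<close>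

lemma bracket_H3_same:
  fixes m y :: "'l list" and vs :: "'l list list" and A B C :: 'l
  defines "f \<equiv> transpose B C"
  assumes d: "gauss ((A # B # m @ A # C # y) # vs)" and s: "sign_valued p"
    and p: "p A = p B" "p B = p C" and adj: "adjacent_in B C y vs"
  shows "bracket p ((A # m @ C # A # map f y @ [B]) # map (map f) vs) =
    bracket p ((A # B # m @ A # C # y) # vs)"
proof -
  have fr: "A \<noteq> B" "A \<noteq> C" "B \<noteq> C" "A \<notin> set m" "A \<notin> set y" "A \<notin> set (concat vs)"
    "B \<notin> set m" "C \<notin> set m"
    by (rule triangle_fresh[OF d adj, of A m]; simp)+
  have fA: "f A = A" "f B = C" "f C = B" "map f m = m" using fr by (simp_all add: f_def)
  have dR: "gauss ((A # m @ C # A # map f y @ [B]) # map (map f) vs)"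
  proof -
    have "gauss ((A # m @ B # A # y @ [C]) # vs)" by (rule gauss_cong[OF d]) (simp add: fun_eq_iff)
    from gauss_transpose[OF this, of B C] show ?thesis using fA by (simp add: f_def)
  qed
  have d1: "gauss ((B # m) # (C # y) # vs)" "gauss ((C # m) # (B # y) # vs)"
    "gauss ((rev m @ B # C # y) # vs)" "gauss ((m @ [B]) # (y @ [C]) # vs)"
    by (rule gauss_remove[OF d, of "{A}"]; use fr in auto)+
  \<comment> \<open>The phrases smoothed with \<open>mark A = p A\<close> are carried to each other by the exchange of
    \<open>B\<close> and \<open>C\<close>.\<close>
  have "map (map f) ((m @ [B]) # (y @ [C]) # vs) = (m @ [C]) # (map f y @ [B]) # map (map f) vs"
    using fA by simp
  then have d2: "gauss ((m @ [C]) # (map f y @ [B]) # map (map f) vs)"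
    using gauss_transpose[OF d1(4), of B C] by (simp add: f_def)
  have "bracket p ((m @ [C]) # (map f y @ [B]) # map (map f) vs) =
      bracket p ((C # m) # (B # map f y) # map (map f) vs)"
    using bracket_front_pair[of "[]" m "[C]" "[]" "map f y" "[B]" "map (map f) vs" p] d2 s by simp
  also have "\<dots> = bracket p (map (map f) ((B # m) # (C # y) # vs))" using fA by simp
  also have "\<dots> = bracket p ((B # m) # (C # y) # vs)"
    unfolding f_def by (rule bracket_transpose[OF d1(1) s p(2)])
  finally have oriented: "bracket p ((m @ [C]) # (map f y @ [B]) # map (map f) vs) =
      bracket p ((B # m) # (C # y) # vs)" .
  \<comment> \<open>The other smoothing of \<open>A\<close> reverses a piece containing one of \<open>B\<close>, \<open>C\<close> once and the other
    not at all, so these two now carry opposite signs and cancel.\<close>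
  obtain red where red: "gauss red" "B \<notin> set (concat red)" "C \<notin> set (concat red)"
    and r: "\<And>p. sign_valued p \<Longrightarrow> p C = - p B \<Longrightarrow> bracket p ((rev m @ B # C # y) # vs) = bracket p red"
      "\<And>p. sign_valued p \<Longrightarrow> p C = - p B \<Longrightarrow>
         bracket p ((C # rev m @ map f y @ [B]) # map (map f) vs) = bracket p red"
    using triangle_reduction[OF d1(3) adj] unfolding f_def by blast
  have "bracket (flip_once (m @ [C]) p) ((C # rev m @ map f y @ [B]) # map (map f) vs) =
      bracket (flip_once (m @ [C]) p) red"
    by (rule r(2)[OF sign_valued_flip[OF s]]) (use fr s p in \<open>auto simp: flip_once_def\<close>)
  also have "\<dots> = bracket (flip_once (B # m) p) red"
    by (rule bracket_cong[OF red(1) sign_valued_flip[OF s] sign_valued_flip[OF s]]) (use s red in \<open>auto simp: flip_once_def\<close>)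
  also have "\<dots> = bracket (flip_once (B # m) p) ((rev m @ B # C # y) # vs)"
    by (rule r(1)[OF sign_valued_flip[OF s], symmetric]) (use fr s p in \<open>auto simp: flip_once_def\<close>)
  finally have unoriented: "bracket (flip_once (m @ [C]) p) ((C # rev m @ map f y @ [B]) # map (map f) vs) =
      bracket (flip_once (B # m) p) ((rev m @ B # C # y) # vs)" .
  show ?thesis
    using bracket_skein_same[of A "m @ [C]" "map f y @ [B]" "map (map f) vs" p] dR
      bracket_skein_same[of A "B # m" "C # y" vs p] d s oriented unoriented by simp
qed

text \<open>The third move when the two occurrences of \<open>A\<close> lie on different components.\<close>

lemma bracket_H3_diff:
  fixes m y :: "'l list" and vs :: "'l list list" and A B C :: 'l
  defines "f \<equiv> transpose B C"
  assumes d: "gauss ((A # B # m) # (A # C # y) # vs)" and s: "sign_valued p"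
    and p: "p A = p B" "p B = p C" and adj: "adjacent_in B C y vs"
  shows "bracket p ((A # m @ [B]) # (A # map f y @ [C]) # map (map f) vs) =
    bracket p ((A # B # m) # (A # C # y) # vs)"
proof -
  have fr: "A \<noteq> B" "A \<noteq> C" "B \<noteq> C" "A \<notin> set m" "A \<notin> set y" "A \<notin> set (concat vs)"
    "B \<notin> set m" "C \<notin> set m"
    by (rule triangle_fresh[OF d adj, of A m]; simp)+
  have fA: "f A = A" "f B = C" "f C = B" "map f m = m" using fr by (simp_all add: f_def)
  have dR: "gauss ((A # m @ [B]) # (A # map f y @ [C]) # map (map f) vs)"
  proof -
    have "gauss ((A # m @ [C]) # (A # y @ [B]) # vs)" by (rule gauss_cong[OF d]) (simp add: fun_eq_iff)
    from gauss_transpose[OF this, of B C] show ?thesis using fA by (simp add: f_def)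
  qed
  have d1: "gauss ((B # m @ C # y) # vs)" "gauss ((m @ C # y @ [B]) # vs)" "gauss ((rev m @ B # C # y) # vs)"
    by (rule gauss_remove[OF d, of "{A}"]; use fr in auto)+
  \<comment> \<open>As for one component, exchanging \<open>B\<close> and \<open>C\<close> relates the phrases smoothed with
    \<open>mark A = p A\<close>.\<close>
  have "map (map f) ((m @ C # y @ [B]) # vs) = (m @ B # map f y @ [C]) # map (map f) vs"
    using fA by simp
  then have d2: "gauss ((m @ B # map f y @ [C]) # map (map f) vs)"
    using gauss_transpose[OF d1(2), of B C] by (simp add: f_def)
  have "bracket p ((m @ B # map f y @ [C]) # map (map f) vs) =
      bracket p ((C # m @ B # map f y) # map (map f) vs)"
    using bracket_shift[of "m @ B # map f y" "[C]" "map (map f) vs" p] d2 s by simp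
  also have "\<dots> = bracket p (map (map f) ((B # m @ C # y) # vs))" using fA by simp
  also have "\<dots> = bracket p ((B # m @ C # y) # vs)"
    unfolding f_def by (rule bracket_transpose[OF d1(1) s p(2)])
  finally have oriented: "bracket p ((m @ B # map f y @ [C]) # map (map f) vs) =
      bracket p ((B # m @ C # y) # vs)" .
  obtain red where red: "gauss red" "B \<notin> set (concat red)" "C \<notin> set (concat red)"
    and r: "\<And>p. sign_valued p \<Longrightarrow> p C = - p B \<Longrightarrow> bracket p ((rev m @ B # C # y) # vs) = bracket p red"
      "\<And>p. sign_valued p \<Longrightarrow> p C = - p B \<Longrightarrow>
         bracket p ((B # rev m @ map f y @ [C]) # map (map f) vs) = bracket p red"
    using triangle_reduction[OF d1(3) adj] unfolding f_def by blast
  have "bracket (flip_once (m @ [B]) p) ((B # rev m @ map f y @ [C]) # map (map f) vs) =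
      bracket (flip_once (m @ [B]) p) red"
    by (rule r(2)[OF sign_valued_flip[OF s]]) (use fr s p in \<open>auto simp: flip_once_def\<close>)
  also have "\<dots> = bracket (flip_once (B # m) p) red"
    by (rule bracket_cong[OF red(1) sign_valued_flip[OF s] sign_valued_flip[OF s]]) (use s red in \<open>auto simp: flip_once_def\<close>)
  also have "\<dots> = bracket (flip_once (B # m) p) ((rev m @ B # C # y) # vs)"
    by (rule r(1)[OF sign_valued_flip[OF s], symmetric]) (use fr s p in \<open>auto simp: flip_once_def\<close>)
  finally have unoriented: "bracket (flip_once (m @ [B]) p) ((B # rev m @ map f y @ [C]) # map (map f) vs) =
      bracket (flip_once (B # m) p) ((rev m @ B # C # y) # vs)" .
  show ?thesis
    using bracket_skein_diff[of A "m @ [B]" "map f y @ [C]" "map (map f) vs" p] dR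
      bracket_skein_diff[of A "B # m" "C # y" vs p] d s oriented unoriented by simp
qed

section \<open>Phrases as words with separators\<close>

text \<open>The inverse of \<^const>\<open>barred\<close>. It turns a decomposition of the word with separators, as in the
moves, into a decomposition of the list of components.\<close>

fun unbar :: "'l option list \<Rightarrow> 'l list list" where
  "unbar [] = [[]]"
| "unbar (None # l) = [] # unbar l"
| "unbar (Some A # l) = (A # hd (unbar l)) # tl (unbar l)"

lemma unbar_not_Nil [simp]: "unbar l \<noteq> []"
  by (cases l rule: unbar.cases) auto

lemma unbar_append:
  "unbar x = us @ [u] \<Longrightarrow> unbar y = w # vs \<Longrightarrow> unbar (x @ y) = us @ (u @ w) # vs"
proof (induction x arbitrary: us u rule: unbar.induct)
  case (2 l)
  then obtain us' where "us = [] # us'" "unbar l = us' @ [u]" by (cases us) auto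
  then show ?case using 2 by simp
next
  case (3 A l)
  then show ?case by (cases us; cases "unbar l") auto
qed simp

lemma unbar_word: "unbar (map Some w @ l) = (w @ hd (unbar l)) # tl (unbar l)"
  by (induction w) auto

lemma unbar_barred: "ws \<noteq> [] \<Longrightarrow> unbar (barred ws) = ws"
proof (induction ws rule: barred.induct)
  case (2 w)
  then show ?case using unbar_word[of w "[]"] by simp
qed (simp_all add: unbar_word)

lemma unbar_filter:
  "unbar (filter (case_option True K) l) = map (filter K) (unbar l)"
proof (induction l rule: unbar.induct)
  case (3 A l)
  then show ?case by (cases "unbar l") auto
qed simp_all

lemma unbar_map: "unbar (map (map_option f) l) = map (map f) (unbar l)"
  by (induction l rule: unbar.induct) (auto simp: hd_map map_tl)

lemma count_concat_unbar: "count_list (concat (unbar l)) A = count_list l (Some A)"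
proof (induction l rule: unbar.induct)
  case (3 B l)
  then show ?case by (cases "unbar l") auto
qed auto

lemma unbar_snoc_cases: obtains us u where "unbar l = us @ [u]"
  by (metis rev_exhaust unbar_not_Nil)

lemma unbar_Cons_cases: obtains w vs where "unbar l = w # vs"
  by (metis neq_Nil_conv unbar_not_Nil)

lemma unbar_both_cases:
  obtains m where "unbar l = [m]" | m1 ms m2 where "unbar l = m1 # ms @ [m2]"
  by (metis append_Nil neq_Nil_conv rev_exhaust unbar_not_Nil append_Cons)

lemma bracket_H1:
  assumes d: "gauss (unbar (x @ [Some A, Some A] @ y))" "gauss (unbar (x @ y))" and s: "sign_valued p"
  shows "bracket p (unbar (x @ [Some A, Some A] @ y)) = - t_pow (3 * p A) * bracket p (unbar (x @ y))"
proof -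
  obtain us u where x: "unbar x = us @ [u]" by (rule unbar_snoc_cases)
  obtain w vs where y: "unbar y = w # vs" by (rule unbar_Cons_cases)
  have v: "unbar (x @ [Some A, Some A] @ y) = us @ (u @ A # A # w) # vs"
    by (rule unbar_append[OF x]) (simp add: y)
  have v': "unbar (x @ y) = us @ (u @ w) # vs" by (rule unbar_append[OF x y])
  have "gauss ((A # A # w @ u) # us @ vs)" by (rule gauss_cong[OF d(1)[unfolded v]]) (simp add: fun_eq_iff)
  from bracket_curl[OF this s] show ?thesis
    using bracket_front[of us u "A # A # w" vs p] bracket_front[of us u w vs p] d s v v' by simp
qed

text \<open>The two strands lie on one component or on two, according to whether \<open>y\<close> contains a separator.\<close>

lemma bracket_H2:
  assumes d: "gauss (unbar (x @ [Some A, Some B] @ y @ [Some B, Some A] @ z))" "gauss (unbar (x @ y @ z))"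
    and s: "sign_valued p" and AB: "p B = - p A"
  shows "bracket p (unbar (x @ [Some A, Some B] @ y @ [Some B, Some A] @ z)) = bracket p (unbar (x @ y @ z))"
proof -
  obtain us u where x: "unbar x = us @ [u]" by (rule unbar_snoc_cases)
  obtain w vs where z: "unbar z = w # vs" by (rule unbar_Cons_cases)
  have BAz: "unbar ([Some B, Some A] @ z) = (B # A # w) # vs" by (simp add: z)
  show ?thesis
  proof (rule unbar_both_cases[of y])
    fix m assume y: "unbar y = [m]"
    have yz: "unbar (y @ z) = (m @ w) # vs" "unbar (y @ [Some B, Some A] @ z) = (m @ B # A # w) # vs"
      using unbar_append[of y "[]" m] y z BAz by auto
    have v: "unbar (x @ [Some A, Some B] @ y @ [Some B, Some A] @ z) = us @ (u @ A # B # m @ B # A # w) # vs"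
      by (rule unbar_append[OF x]) (use yz(2) in simp)
    have v': "unbar (x @ y @ z) = us @ (u @ m @ w) # vs" by (rule unbar_append[OF x yz(1)])
    have "gauss ((A # B # m @ B # A # w @ u) # us @ vs)" by (rule gauss_cong[OF d(1)[unfolded v]]) (simp add: fun_eq_iff)
    from bracket_R2_antiparallel_same[OF this s AB] show ?thesis
      using bracket_front[of us u "A # B # m @ B # A # w" vs p] bracket_front[of us u "m @ w" vs p] d s v v'
      by simp
  next
    fix m1 ms m2 assume y: "unbar y = m1 # ms @ [m2]"
    have yz: "unbar (y @ z) = m1 # ms @ (m2 @ w) # vs"
      "unbar (y @ [Some B, Some A] @ z) = m1 # ms @ (m2 @ B # A # w) # vs"
      using unbar_append[of y "m1 # ms" m2] y z BAz by auto
    have v: "unbar (x @ [Some A, Some B] @ y @ [Some B, Some A] @ z) =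
        us @ (u @ A # B # m1) # ms @ (m2 @ B # A # w) # vs"
      by (rule unbar_append[OF x]) (use yz(2) in simp)
    have v': "unbar (x @ y @ z) = us @ (u @ m1) # ms @ (m2 @ w) # vs" by (rule unbar_append[OF x yz(1)])
    have "gauss ((A # B # m1 @ u) # (B # A # w @ m2) # us @ ms @ vs)"
      by (rule gauss_cong[OF d(1)[unfolded v]]) (simp add: fun_eq_iff)
    from bracket_R2_antiparallel_diff[OF this s AB] show ?thesis
      using bracket_front_pair[of us u "A # B # m1" ms m2 "B # A # w" vs p]
        bracket_front_pair[of us u m1 ms m2 w vs p] d s v v' by simp
  qed
qed

lemma adjacent_mono:
  "adjacent_in B C r rs \<Longrightarrow> adjacent_in B C (r @ u) (us @ rs)"
  unfolding adjacent_in_def by (metis append.assoc append_Cons)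

lemma unbar_adjacent:
  assumes "unbar (z @ [Some B, Some C] @ t) = r # rs"
  shows "adjacent_in B C r rs"
proof -
  obtain us u where z: "unbar z = us @ [u]" by (rule unbar_snoc_cases)
  obtain w vs where t: "unbar t = w # vs" by (rule unbar_Cons_cases)
  have "unbar (z @ [Some B, Some C] @ t) = us @ (u @ B # C # w) # vs"
    by (rule unbar_append[OF z]) (simp add: t)
  then have "r # rs = us @ (u @ B # C # w) # vs" using assms by simp
  then have "r = u @ B # C # w \<or> rs = tl us @ (u @ B # C # w) # vs" by (cases us) auto
  then show ?thesis unfolding adjacent_in_def by blast
qed

lemma map_option_transpose_idle:
  "Some B \<notin> set l \<Longrightarrow> Some C \<notin> set l \<Longrightarrow> map (map_option (transpose B C)) l = l"
proof (rule map_idI)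
  fix a assume "Some B \<notin> set l" "Some C \<notin> set l" "a \<in> set l"
  then show "map_option (transpose B C) a = a" by (cases a) (auto simp: transpose_def)
qed

lemma bracket_H3:
  assumes d: "gauss (unbar (x @ [Some A, Some B] @ y @ [Some A, Some C] @ z @ [Some B, Some C] @ t))"
    and s: "sign_valued p" and p: "p A = p B" "p B = p C"
    and d': "gauss (unbar (x @ [Some B, Some A] @ y @ [Some C, Some A] @ z @ [Some C, Some B] @ t))"
  shows "bracket p (unbar (x @ [Some B, Some A] @ y @ [Some C, Some A] @ z @ [Some C, Some B] @ t)) =
    bracket p (unbar (x @ [Some A, Some B] @ y @ [Some A, Some C] @ z @ [Some B, Some C] @ t))"
proof -
  let ?f = "transpose B C"
  define v where "v = unbar (x @ [Some A, Some B] @ y @ [Some A, Some C] @ z @ [Some B, Some C] @ t)"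
  define v' where "v' = unbar (x @ [Some B, Some A] @ y @ [Some C, Some A] @ z @ [Some C, Some B] @ t)"
  note c = d[unfolded gauss_def count_concat_unbar]
  have fr: "Some B \<notin> set x" "Some C \<notin> set x" "Some B \<notin> set y" "Some C \<notin> set y"
    "Some B \<notin> set z" "Some C \<notin> set z" "Some B \<notin> set t" "Some C \<notin> set t"
    using spec[OF c, of B] spec[OF c, of C] by (auto simp flip: count_list_0_iff split: if_splits)
  obtain us u where x: "unbar x = us @ [u]" by (rule unbar_snoc_cases)
  obtain r rs where r: "unbar (z @ [Some B, Some C] @ t) = r # rs" by (rule unbar_Cons_cases)
  note adj = unbar_adjacent[OF r]
  have "z @ [Some C, Some B] @ t = map (map_option ?f) (z @ [Some B, Some C] @ t)"
    using fr by (simp add: map_option_transpose_idle)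
  then have r': "unbar (z @ [Some C, Some B] @ t) = map ?f r # map (map ?f) rs"
    by (metis list.simps(9) r unbar_map)
  have idle: "map (map ?f) (unbar l) = unbar l" if "Some B \<notin> set l" "Some C \<notin> set l" for l
    by (metis map_option_transpose_idle that unbar_map)
  have fx: "map (map ?f) us = us" "map ?f u = u" using idle[OF fr(1,2)] by (simp_all add: x)
  have ACr: "unbar ([Some A, Some C] @ z @ [Some B, Some C] @ t) = (A # C # r) # rs"
    "unbar ([Some C, Some A] @ z @ [Some C, Some B] @ t) = (C # A # map ?f r) # map (map ?f) rs"
    using r r' by simp_all
  show ?thesis
  proof (rule unbar_both_cases[of y])
    fix m assume y: "unbar y = [m]"
    note ya = unbar_append[of y "[]" m, simplified, OF y]
    have "unbar ([Some A, Some B] @ y @ [Some A, Some C] @ z @ [Some B, Some C] @ t) =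
        (A # B # m @ A # C # r) # rs" using ya[OF ACr(1)] by simp
    then have v: "v = us @ (u @ A # B # m @ A # C # r) # rs" unfolding v_def by (rule unbar_append[OF x])
    have "unbar ([Some B, Some A] @ y @ [Some C, Some A] @ z @ [Some C, Some B] @ t) =
        (B # A # m @ C # A # map ?f r) # map (map ?f) rs" using ya[OF ACr(2)] by simp
    then have v': "v' = us @ (u @ B # A # m @ C # A # map ?f r) # map (map ?f) rs"
      unfolding v'_def by (rule unbar_append[OF x])
    have "bracket p v' = bracket p ((A # m @ C # A # map ?f r @ u @ [B]) # us @ map (map ?f) rs)"
      using bracket_front[of us "u @ [B]" "A # m @ C # A # map ?f r" "map (map ?f) rs" p] d' s v'
      unfolding v'_def by simp
    also have "\<dots> = bracket p ((A # m @ C # A # map ?f (r @ u) @ [B]) # map (map ?f) (us @ rs))"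
      using fx by simp
    also have "\<dots> = bracket p ((A # B # m @ A # C # r @ u) # us @ rs)"
    proof (rule bracket_H3_same)
      show "gauss ((A # B # m @ A # C # r @ u) # us @ rs)"
        by (rule gauss_cong[OF d[folded v_def, unfolded v]]) (simp add: fun_eq_iff)
    qed (use s p adj in \<open>auto intro: adjacent_mono\<close>)
    also have "\<dots> = bracket p v"
      using bracket_front[of us u "A # B # m @ A # C # r" rs p] d s v unfolding v_def by simp
    finally show ?thesis unfolding v_def v'_def .
  next
    fix m1 ms m2 assume y: "unbar y = m1 # ms @ [m2]"
    have fy: "map (map ?f) ms = ms" "map ?f m2 = m2" using idle[OF fr(3,4)] by (simp_all add: y)
    note ya = unbar_append[of y "m1 # ms" m2, simplified, OF y]
    have "unbar ([Some A, Some B] @ y @ [Some A, Some C] @ z @ [Some B, Some C] @ t) =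
        (A # B # m1) # ms @ (m2 @ A # C # r) # rs" using ya[OF ACr(1)] by simp
    then have v: "v = us @ (u @ A # B # m1) # ms @ (m2 @ A # C # r) # rs"
      unfolding v_def by (rule unbar_append[OF x])
    have "unbar ([Some B, Some A] @ y @ [Some C, Some A] @ z @ [Some C, Some B] @ t) =
        (B # A # m1) # ms @ (m2 @ C # A # map ?f r) # map (map ?f) rs"
      using ya[OF ACr(2)] by simp
    then have v': "v' = us @ (u @ B # A # m1) # ms @ (m2 @ C # A # map ?f r) # map (map ?f) rs"
      unfolding v'_def by (rule unbar_append[OF x])
    have "bracket p v' = bracket p ((A # m1 @ u @ [B]) # (A # map ?f r @ m2 @ [C]) # us @ ms @ map (map ?f) rs)"
      using bracket_front_pair[of us "u @ [B]" "A # m1" ms "m2 @ [C]" "A # map ?f r" "map (map ?f) rs" p]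
        d' s v' unfolding v'_def by simp
    also have "\<dots> = bracket p ((A # (m1 @ u) @ [B]) # (A # map ?f (r @ m2) @ [C]) # map (map ?f) ((us @ ms) @ rs))"
      using fx fy by simp
    also have "\<dots> = bracket p ((A # B # m1 @ u) # (A # C # r @ m2) # (us @ ms) @ rs)"
    proof (rule bracket_H3_diff)
      show "gauss ((A # B # m1 @ u) # (A # C # r @ m2) # (us @ ms) @ rs)"
        by (rule gauss_cong[OF d[folded v_def, unfolded v]]) (simp add: fun_eq_iff)
    qed (use s p adj in \<open>auto intro: adjacent_mono simp del: append_assoc\<close>)
    also have "\<dots> = bracket p v"
      using bracket_front_pair[of us u "A # B # m1" ms m2 "A # C # r" rs p] d s v unfolding v_def by simp
    finally show ?thesis unfolding v_def v'_def .
  qed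
qed

section \<open>The Jones polynomial of the reduced nanophrase\<close>

lemma neg_t_pow_eq: "neg_t_pow n = (if even n then t_pow n else - t_pow n)"
proof -
  have pw: "t_pow m ^ k = t_pow (int k * m)" for m k
    by (induction k) (simp_all add: t_pow_mult algebra_simps)
  show ?thesis
  proof (cases "0 \<le> n")
    case True
    then have "(- t_pow 1) ^ nat n = (if even n then t_pow n else - t_pow n)"
      by (simp add: power_minus_even power_minus_odd pw even_nat_iff)
    then show ?thesis using True by (simp add: neg_t_pow_def)
  next
    case False
    then have "(- t_pow (- 1)) ^ nat (- n) = (if even n then t_pow n else - t_pow n)"
      by (simp add: power_minus_even power_minus_odd pw even_nat_iff)
    then show ?thesis using False by (simp add: neg_t_pow_def)
  qed
qed

lemma jones_eq_bracket:
  assumes "letters Q = set (concat (comps Q))"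
  shows "jones Q = neg_t_pow (- 3 * writhe Q) * bracket (proj Q) (comps Q)"
proof -
  have fin: "finite (letters Q)" using assms by simp
  have "state_sigma Q s = sum s (letters Q)" if s: "s \<in> letters Q \<rightarrow>\<^sub>E {- 1, 1}" for s
  proof -
    have "letters Q = {A \<in> letters Q. s A = 1} \<union> {A \<in> letters Q. s A = - 1}" using s by (auto simp: PiE_iff)
    then have "sum s (letters Q) = sum s {A \<in> letters Q. s A = 1} + sum s {A \<in> letters Q. s A = - 1}"
      using fin by (subst sum.union_disjoint[symmetric]) auto
    then show ?thesis by (simp add: state_sigma_def)
  qed
  then show ?thesis
    unfolding jones_def bracket_def state_comps_def loop_count_def assms by simp
qed

definition signed_letter :: "('a \<Rightarrow> 'a) \<Rightarrow> 'a set \<Rightarrow> ('l \<Rightarrow> 'a) \<Rightarrow> 'l \<Rightarrow> bool" where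
  "signed_letter \<tau> L p A \<longleftrightarrow> sign_L \<tau> L (p A) \<noteq> 0"

text \<open>The value \<open>- 1\<close> at letters without a sign is a default; it keeps the projection total and these
letters do not occur in the reduced phrase.\<close>

definition unit_sign :: "('a \<Rightarrow> 'a) \<Rightarrow> 'a set \<Rightarrow> ('l \<Rightarrow> 'a) \<Rightarrow> 'l \<Rightarrow> int" where
  "unit_sign \<tau> L p A = (if sign_L \<tau> L (p A) = 1 then 1 else - 1)"

lemma sign_valued_unit_sign [simp]: "sign_valued (unit_sign \<tau> L p)"
  by (simp add: sign_valued_def unit_sign_def)

lemma nanophrase_facts:
  assumes "nanophrase \<alpha> (Phrase X p v)"
  shows "v \<noteq> []" "finite X" "X = set (concat v)" "gauss v" "gauss (map (filter K) v)"
proof -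
  show "v \<noteq> []" "finite X" using assms by (auto simp: nanophrase_def)
  show X: "X = set (concat v)"
    using assms unfolding nanophrase_def phrase.sel by (metis count_list_0_iff subsetI subset_antisym zero_neq_numeral)
  show "gauss v" using assms unfolding nanophrase_def phrase.sel gauss_def X[symmetric]
    by (metis X count_list_0_iff)
  moreover have "count_list (filter K w) A = (if K A then count_list w A else 0)" for w A
    by (induction w) auto
  ultimately show "gauss (map (filter K) v)" unfolding gauss_def filter_concat[symmetric] by simp
qed

lemma jones_U_L:
  assumes "nanophrase \<alpha> (Phrase X p v)"
  shows "jones (to_signs (U_L \<tau> L (Phrase X p v))) =
    neg_t_pow (- 3 * (\<Sum>A\<in>{A \<in> X. signed_letter \<tau> L p A}. unit_sign \<tau> L p A)) *
    bracket (unit_sign \<tau> L p) (map (filter (signed_letter \<tau> L p)) v)"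
proof -
  have "alpha0_sign \<circ> (\<lambda>A. if sign_L \<tau> L (p A) = 1 then a0 else b0) = unit_sign \<tau> L p"
    by (auto simp: unit_sign_def fun_eq_iff)
  then have Q: "to_signs (U_L \<tau> L (Phrase X p v)) = Phrase {A \<in> X. signed_letter \<tau> L p A}
      (unit_sign \<tau> L p) (map (filter (signed_letter \<tau> L p)) v)"
    by (simp add: to_signs_def U_L_def signed_letter_def[abs_def])
  have "{A \<in> X. signed_letter \<tau> L p A} = set (concat (map (filter (signed_letter \<tau> L p)) v))"
    using nanophrase_facts(3)[OF assms] by auto
  then show ?thesis unfolding Q by (subst jones_eq_bracket) (simp_all add: writhe_def)
qed

text \<open>A free orbit contains only one representative, so \<open>a\<close> and \<open>\<tau> a\<close> are not both in \<open>L\<close>; a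
letter whose orbit is not free has sign zero.\<close>

lemma sign_L_involution:
  assumes \<tau>: "involution_on \<alpha> \<tau>" and C: "complete_reps \<alpha> \<tau> C" "L \<subseteq> C" and a: "a \<in> \<alpha>"
  shows "sign_L \<tau> L (\<tau> a) = - sign_L \<tau> L a"
proof -
  have tt: "\<tau> (\<tau> a) = a" using \<tau> a by (simp add: involution_on_def)
  then have orb: "orbit_of \<tau> (\<tau> a) = orbit_of \<tau> a" by (auto simp: orbit_of_def)
  have L: "L \<subseteq> \<alpha>" using C by (auto simp: complete_reps_def)
  have ttL: "\<tau> (\<tau> l) = l" if "l \<in> L" for l using that L \<tau> by (auto simp: involution_on_def)
  have 1: "\<tau> a \<in> \<tau> ` L \<longleftrightarrow> a \<in> L"
  proof
    assume "\<tau> a \<in> \<tau> ` L"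
    then obtain l where l: "l \<in> L" "\<tau> a = \<tau> l" by auto
    then have "\<tau> (\<tau> a) = \<tau> (\<tau> l)" by simp
    then show "a \<in> L" using l(1) ttL[OF l(1)] tt by simp
  qed simp
  have 2: "\<tau> a \<in> L \<longleftrightarrow> a \<in> \<tau> ` L"
  proof
    assume "\<tau> a \<in> L"
    then show "a \<in> \<tau> ` L" by (rule rev_image_eqI) (simp add: tt)
  next
    assume "a \<in> \<tau> ` L"
    then obtain l where l: "l \<in> L" "a = \<tau> l" by auto
    then show "\<tau> a \<in> L" using ttL[OF l(1)] by simp
  qed
  have "a = \<tau> a" if "a \<in> L" "\<tau> a \<in> L"
  proof -
    have "\<exists>!c. c \<in> C \<and> c \<in> orbit_of \<tau> a" using C(1) a by (auto simp: complete_reps_def)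
    then show ?thesis using that C(2) by (auto simp: orbit_of_def)
  qed
  then have 3: "\<not> (a \<in> L \<and> \<tau> a \<in> L)" if "free_orbit (orbit_of \<tau> a)"
    using that by (auto simp: free_orbit_def orbit_of_def)
  show ?thesis unfolding sign_L_def orb 1 2[symmetric] using 3 by auto
qed

lemma unbar_filter_barred:
  "v \<noteq> [] \<Longrightarrow> map (filter K) v = unbar (filter (case_option True K) (barred v))"
  by (simp add: unbar_filter unbar_barred)

text \<open>In each move the displayed letters are all kept or all deleted by the reduction, because their
signs agree up to a factor \<open>- 1\<close>.\<close>

lemma jones_U_L_homotopy_move:
  assumes \<tau>: "involution_on \<alpha> \<tau>" and C: "complete_reps \<alpha> \<tau> C" "L \<subseteq> C"
    and "homotopy_move \<alpha> \<tau> (diagonal \<alpha>) P P'"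
  shows "jones (to_signs (U_L \<tau> L P)) = jones (to_signs (U_L \<tau> L P'))"
  using assms(4)
proof cases
  case iso
  obtain X p v where P: "P = Phrase X p v" by (cases P)
  obtain X' p' v' where P': "P' = Phrase X' p' v'" by (cases P')
  note n = iso(1)[unfolded P] and n' = iso(2)[unfolded P']
  from iso(3) obtain f where f: "bij_betw f X X'" "\<And>A. A \<in> X \<Longrightarrow> p' (f A) = p A" "v' = map (map f) v"
    unfolding isomorphic_def P P' by auto
  let ?K = "signed_letter \<tau> L p" and ?K' = "signed_letter \<tau> L p'"
  let ?q = "unit_sign \<tau> L p" and ?q' = "unit_sign \<tau> L p'"
  have K: "?K' (f A) = ?K A" "?q' (f A) = ?q A" if "A \<in> X" for A
    using f(2)[OF that] by (simp_all add: signed_letter_def unit_sign_def)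
  have X: "X = set (concat v)" by (rule nanophrase_facts(3)[OF n])
  have "filter ?K' (map f w) = map f (filter ?K w)" if "w \<in> set v" for w
    unfolding filter_map using that K X by (intro arg_cong[where f = "map f"] filter_cong) auto
  then have w: "map (filter ?K') v' = map (map f) (map (filter ?K) v)" unfolding f(3) by simp
  have b: "bracket ?q' (map (map f) (map (filter ?K) v)) = bracket ?q (map (filter ?K) v)"
  proof (rule bracket_relabel)
    show "inj_on f (set (concat (map (filter ?K) v)))"
      by (rule inj_on_subset[OF bij_betw_imp_inj_on[OF f(1)]]) (auto simp: X)
  qed (use nanophrase_facts(5)[OF n] nanophrase_facts(5)[OF n', of ?K'] K X w in auto)
  have "bij_betw f {A \<in> X. ?K A} {A \<in> X'. ?K' A}"
    using f(1) K unfolding bij_betw_def by (auto intro: inj_on_subset)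
  then have "(\<Sum>A\<in>{A \<in> X'. ?K' A}. ?q' A) = (\<Sum>A\<in>{A \<in> X. ?K A}. ?q' (f A))"
    by (rule sum.reindex_bij_betw[symmetric])
  also have "\<dots> = (\<Sum>A\<in>{A \<in> X. ?K A}. ?q A)" by (rule sum.cong) (auto simp: K)
  finally show ?thesis unfolding P P' jones_U_L[OF n] jones_U_L[OF n'] w b by simp
next
  case (H1 X p v A v' x y)
  let ?K = "signed_letter \<tau> L p" and ?q = "unit_sign \<tau> L p"
  let ?F = "filter (case_option True ?K)"
  note n = nanophrase_facts[OF H1(3)] and n' = nanophrase_facts[OF H1(4)]
  have v: "map (filter ?K) v = unbar (?F (barred v))" "map (filter ?K) v' = unbar (?F (barred v'))"
    using n(1) n'(1) by (simp_all add: unbar_filter_barred)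
  note dv = n(5)[of ?K, unfolded v] n'(5)[of ?K, unfolded v]
  have A: "A \<in> X"
  proof -
    have "count_list (concat v) A \<noteq> 0"
      using count_concat_unbar[of "barred v" A] unbar_barred[OF n(1)] by (simp add: H1(5))
    then show ?thesis unfolding n(3) by (metis count_list_0_iff)
  qed
  show ?thesis
  proof (cases "?K A")
    case False
    then have "{B \<in> X - {A}. ?K B} = {B \<in> X. ?K B}" "?F (barred v') = ?F (barred v)"
      by (auto simp: H1(5,6))
    then show ?thesis unfolding H1(1,2) jones_U_L[OF H1(3)] jones_U_L[OF H1(4)] v by simp
  next
    case True
    have b: "bracket ?q (unbar (?F (barred v))) = - t_pow (3 * ?q A) * bracket ?q (unbar (?F (barred v')))"
      using bracket_H1[of "?F x" A "?F y" ?q] dv True by (simp add: H1(5,6))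
    have "{B \<in> X. ?K B} = insert A {B \<in> X - {A}. ?K B}" using True A by auto
    then have W: "sum ?q {B \<in> X. ?K B} = ?q A + sum ?q {B \<in> X - {A}. ?K B}" using n(2) by simp
    have "neg_t_pow (- 3 * (?q A + k)) * (- t_pow (3 * ?q A) * c) = neg_t_pow (- 3 * k) * c" for k c
    proof -
      have "neg_t_pow (- 3 * (?q A + k)) * - t_pow (3 * ?q A) = neg_t_pow (- 3 * k)"
        by (auto simp: neg_t_pow_eq t_pow_mult unit_sign_def algebra_simps)
      then show ?thesis by (metis mult.assoc)
    qed
    then show ?thesis unfolding H1(1,2) jones_U_L[OF H1(3)] jones_U_L[OF H1(4)] v b W by simp
  qed
next
  case (H2 X p v A B v' x y z)
  let ?K = "signed_letter \<tau> L p" and ?q = "unit_sign \<tau> L p"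
  let ?F = "filter (case_option True ?K)"
  note n = nanophrase_facts[OF H2(3)] and n' = nanophrase_facts[OF H2(4)]
  have v: "map (filter ?K) v = unbar (?F (barred v))" "map (filter ?K) v' = unbar (?F (barred v'))"
    using n(1) n'(1) by (simp_all add: unbar_filter_barred)
  note dv = n(5)[of ?K, unfolded v] n'(5)[of ?K, unfolded v]
  have c: "count_list (concat v) Z = count_list (barred v) (Some Z)" for Z
    using count_concat_unbar[of "barred v" Z] unbar_barred[OF n(1)] by simp
  have "count_list (concat v) A \<noteq> 0" "count_list (concat v) B \<noteq> 0" by (simp_all add: c H2(6))
  then have AB: "A \<in> X" "B \<in> X" unfolding n(3) by (metis count_list_0_iff)+
  have ne: "A \<noteq> B" using spec[OF n(4)[unfolded gauss_def], of A] by (auto simp: c H2(6))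
  have "p A \<in> \<alpha>" using H2(3) AB by (auto simp: nanophrase_def)
  then have sg: "sign_L \<tau> L (p B) = - sign_L \<tau> L (p A)"
    using sign_L_involution[OF \<tau> C] H2(5) by metis
  then have KB: "?K B = ?K A" by (simp add: signed_letter_def)
  show ?thesis
  proof (cases "?K A")
    case False
    then have "{Z \<in> X - {A, B}. ?K Z} = {Z \<in> X. ?K Z}" "?F (barred v') = ?F (barred v)"
      using KB by (auto simp: H2(6,7))
    then show ?thesis unfolding H2(1,2) jones_U_L[OF H2(3)] jones_U_L[OF H2(4)] v by simp
  next
    case True
    have q: "?q B = - ?q A"
      using sg True by (auto simp: unit_sign_def signed_letter_def sign_L_def split: if_splits)
    have b: "bracket ?q (unbar (?F (barred v))) = bracket ?q (unbar (?F (barred v')))"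
      using bracket_H2[of "?F x" A B "?F y" "?F z" ?q] dv True KB q by (simp add: H2(6,7))
    have "{Z \<in> X. ?K Z} = insert A (insert B {Z \<in> X - {A, B}. ?K Z})" using True KB AB by auto
    then have W: "sum ?q {Z \<in> X. ?K Z} = sum ?q {Z \<in> X - {A, B}. ?K Z}" using n(2) ne q by simp
    show ?thesis unfolding H2(1,2) jones_U_L[OF H2(3)] jones_U_L[OF H2(4)] v b W ..
  qed
next
  case (H3 X p v v' A B C x y z t)
  let ?K = "signed_letter \<tau> L p" and ?q = "unit_sign \<tau> L p"
  let ?F = "filter (case_option True ?K)"
  note n = nanophrase_facts[OF H3(3)] and n' = nanophrase_facts[OF H3(4)]
  have v: "map (filter ?K) v = unbar (?F (barred v))" "map (filter ?K) v' = unbar (?F (barred v'))"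
    using n(1) n'(1) by (simp_all add: unbar_filter_barred)
  note dv = n(5)[of ?K, unfolded v] n'(5)[of ?K, unfolded v]
  have p: "p A = p B" "p B = p C" using H3(5) by (auto simp: diagonal_def)
  then have KB: "?K B = ?K A" "?K C = ?K A" and q: "?q A = ?q B" "?q B = ?q C"
    by (simp_all add: signed_letter_def unit_sign_def)
  have "bracket ?q (unbar (?F (barred v'))) = bracket ?q (unbar (?F (barred v)))"
  proof (cases "?K A")
    case False
    then show ?thesis using KB by (simp add: H3(6,7))
  next
    case True
    then show ?thesis
      using bracket_H3[of "?F x" A B "?F y" C "?F z" "?F t" ?q] dv KB q
      by (simp add: H3(6,7))
  qed
  then show ?thesis unfolding H3(1,2) jones_U_L[OF H3(3)] jones_U_L[OF H3(4)] v by simp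
qed

theorem corollary4:
  fixes \<alpha> :: "'a set" and \<tau> :: "'a \<Rightarrow> 'a" and C L :: "'a set"
    and P P' :: "('l, 'a) phrase"
  assumes "finite \<alpha>"
    and "involution_on \<alpha> \<tau>"
    and "complete_reps \<alpha> \<tau> C"
    and "L \<subseteq> C"
    and "nanophrase \<alpha> P"
    and "nanophrase \<alpha> P'"
    and "homotopic \<alpha> \<tau> (diagonal \<alpha>) P P'"
  shows "jones (to_signs (U_L \<tau> L P)) = jones (to_signs (U_L \<tau> L P'))"
  using assms(7) unfolding homotopic_def
proof (induction rule: equivclp_induct)
  case (step Q R)
  then show ?case using jones_U_L_homotopy_move[OF assms(2-4)] by metis
qed simp

end
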